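(* Let $P,Q\ge 1$ and let $j_1,\dots,j_P$, $k_1,\dots,k_Q$, $j\in\frac{1}{2}\mathbb{N}$ be fixed spins. Let $\mathcal{I}\in\mathcal{H}^0_{AB}=\mathcal{H}^0_A\otimes\mathcal{H}^0_B$ be an arbitrary normalized state (an arbitrary superposition of tensor products of intertwiners, not necessarily a product state). Let $E(A|B)$ be the intertwiner entanglement of $\mathcal{I}$, and let $\widetilde{E}(A|B)$ be the boundary spin state entanglement of the (normalized) boundary state obtained from $\mathcal{P}[\mathcal{I}]\in H^{\partial}_{AB}$ by gluing along the common spin-$j$ edge. Then $$\widetilde{E}(A|B)=E(A|B)+\ln(2j+1).$$
   Context: For a spin $j\in\frac12\mathbb{N}=\{0,\frac12,1,\dots\}$, $V^j$ is the irreducible unitary representation of $\mathrm{SU}(2)$ of dimension $2j+1$, with standard orthonormal basis $|j,m\rangle$, $m=-j,-j+1,\dots,j$, diagonalizing $J^z$ (standard phase convention: $J^{\pm}=J^x\pm iJ^y$ have non-negative matrix elements). Intertwiner spaces: $\mathcal{H}^0_A=\mathrm{Inv}_{\mathrm{SU}(2)}[V^{j_1}\otimes\cdots\otimes V^{j_P}\otimes V^j]$ and $\mathcal{H}^0_B=\mathrm{Inv}_{\mathrm{SU}(2)}[V^{k_1}\otimes\cdots\otimes V^{k_Q}\otimes V^j]$ are the subspaces of $\mathrm{SU}(2)$-invariant vectors under the diagonal action, with the induced inner products, and $\mathcal{H}^0_{AB}=\mathcal{H}^0_A\otimes\mathcal{H}^0_B$. Boundary spaces: $H_A=V^{j_1}\otimes\cdots\otimes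 V^{j_P}$, $H_B=V^{k_1}\otimes\cdots\otimes V^{k_Q}$, $H^{\partial}_{AB}=H_A\otimes H_B$. Gluing map: $\mathcal{P}:\mathcal{H}^0_{AB}\to H^{\partial}_{AB}$ is the linear map with $$\mathcal{P}[I_A\otimes I_B]=\frac{1}{\sqrt{2j+1}}\sum_{m=-j}^{j}(-1)^{j-m}\,\langle j,m|I_A\otimes\langle j,-m|I_B,$$ where $\langle j,m|I_A\in H_A$ denotes the partial contraction of $I_A\in H_A\otimes V^j$ with $\langle j,m|$ on the factor $V^j$, and similarly for $B$. Entanglement: for a unit vector $\phi$ in a tensor product $X\otimes Y$ of finite-dimensional Hilbert spaces, its entanglement (between $X$ and $Y$) is the von Neumann entropy $-\mathrm{Tr}\,\rho_X\ln\rho_X$ of $\rho_X=\mathrm{Tr}_Y|\phi\rangle\langle\phi|$ (with $0\ln 0=0$). The intertwiner entanglement $E(A|B)$ of a unit vector $\psi\in\mathcal{H}^0_{AB}$ is its entanglement with respect to $\mathcal{H}^0_A\otimes\mathcal{H}^0_B$. The boundary spin state entanglement $\widetilde{E}(A|B)$ of $\psi$ is the entanglement with respect to $H_A\otimes H_B$ of the normalized vector $\mathcal{P}[\psi]/\|\mathcal{P}[\psi]\|$. *)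

theory Defs
  imports "HOL-Analysis.Analysis" "HOL-Computational_Algebra.Polynomial"
begin

text \<open>
  A vector of a finite-dimensional coordinate Hilbert space is a function from an index type to
  the complex numbers, together with an explicit finite set \<open>I\<close> of relevant indices; the inner
  product is antilinear in its first argument.  Subspaces are sets of such functions.
\<close>

definition cinner :: "'i set \<Rightarrow> ('i \<Rightarrow> complex) \<Rightarrow> ('i \<Rightarrow> complex) \<Rightarrow> complex" where
  "cinner I u v = (\<Sum>i\<in>I. cnj (u i) * v i)"

definition cnorm :: "'i set \<Rightarrow> ('i \<Rightarrow> complex) \<Rightarrow> real" where
  "cnorm I v = sqrt (Re (cinner I v v))"

definition normalized :: "'i set \<Rightarrow> ('i \<Rightarrow> complex) \<Rightarrow> 'i \<Rightarrow> complex" where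
  "normalized I v = (\<lambda>i. v i / of_real (cnorm I v))"

definition orthonormal_basis ::
    "'i set \<Rightarrow> ('i \<Rightarrow> complex) set \<Rightarrow> ('i \<Rightarrow> complex) list \<Rightarrow> bool" where
  "orthonormal_basis I X es \<longleftrightarrow>
     set es \<subseteq> X \<and>
     (\<forall>a<length es. \<forall>b<length es. cinner I (es ! a) (es ! b) = (if a = b then 1 else 0)) \<and>
     (\<forall>x\<in>X. \<exists>c::nat \<Rightarrow> complex. x = (\<lambda>i. \<Sum>a<length es. c a * (es ! a) i))"

definition some_onb :: "'i set \<Rightarrow> ('i \<Rightarrow> complex) set \<Rightarrow> ('i \<Rightarrow> complex) list" where
  "some_onb I X = (SOME es. orthonormal_basis I X es)"

definition op_trace ::
    "'i set \<Rightarrow> ('i \<Rightarrow> complex) set \<Rightarrow> (('i \<Rightarrow> complex) \<Rightarrow> ('i \<Rightarrow> complex)) \<Rightarrow> complex" where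
  "op_trace I X T = (\<Sum>e\<leftarrow>some_onb I X. cinner I e (T e))"

definition spectral_decomposition ::
    "'i set \<Rightarrow> ('i \<Rightarrow> complex) set \<Rightarrow> (('i \<Rightarrow> complex) \<Rightarrow> ('i \<Rightarrow> complex))
       \<Rightarrow> ('i \<Rightarrow> complex) list \<Rightarrow> real list \<Rightarrow> bool" where
  "spectral_decomposition I X T es ps \<longleftrightarrow>
     orthonormal_basis I X es \<and> length ps = length es \<and>
     (\<forall>a<length es. T (es ! a) = (\<lambda>i. of_real (ps ! a) * (es ! a) i))"

text \<open>
  Functional calculus \<open>g(T) = \<Sum>\<^sub>a g(p\<^sub>a) |e\<^sub>a\<rangle>\<langle>e\<^sub>a|\<close> for a self-adjoint operator \<open>T\<close> on \<open>X\<close>; on \<open>X\<close> the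
  result does not depend on the chosen eigenbasis.
\<close>

definition op_fun ::
    "'i set \<Rightarrow> ('i \<Rightarrow> complex) set \<Rightarrow> (real \<Rightarrow> real) \<Rightarrow> (('i \<Rightarrow> complex) \<Rightarrow> ('i \<Rightarrow> complex))
       \<Rightarrow> (('i \<Rightarrow> complex) \<Rightarrow> ('i \<Rightarrow> complex))" where
  "op_fun I X g T x =
     (let (es, ps) = (SOME (es, ps). spectral_decomposition I X T es ps)
      in (\<lambda>i. \<Sum>a<length es. of_real (g (ps ! a)) * cinner I (es ! a) x * (es ! a) i))"

text \<open>
  The convention \<open>0 ln 0 = 0\<close> is automatic: \<open>ln \<rho>\<close> maps the kernel of \<open>\<rho>\<close> into itself.
\<close>

definition von_neumann_entropy ::
    "'i set \<Rightarrow> ('i \<Rightarrow> complex) set \<Rightarrow> (('i \<Rightarrow> complex) \<Rightarrow> ('i \<Rightarrow> complex)) \<Rightarrow> real" where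
  "von_neumann_entropy I X \<rho> = - Re (op_trace I X (\<lambda>x. \<rho> (op_fun I X ln \<rho> x)))"

definition tensor_space ::
    "('i \<Rightarrow> complex) set \<Rightarrow> ('j \<Rightarrow> complex) set \<Rightarrow> ('i \<times> 'j \<Rightarrow> complex) set" where
  "tensor_space X Y =
     {\<phi>. \<exists>(n::nat) x y. (\<forall>r<n. x r \<in> X \<and> y r \<in> Y) \<and> \<phi> = (\<lambda>(a, b). \<Sum>r<n. x r a * y r b)}"

text \<open>The contraction \<open>\<langle>f|\<phi>\<rangle>\<close> on the second tensor factor:\<close>

definition partial_inner ::
    "'j set \<Rightarrow> ('j \<Rightarrow> complex) \<Rightarrow> ('i \<times> 'j \<Rightarrow> complex) \<Rightarrow> 'i \<Rightarrow> complex" where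
  "partial_inner J f \<phi> = (\<lambda>i. \<Sum>j\<in>J. cnj (f j) * \<phi> (i, j))"

text \<open>\<open>Tr\<^sub>Y |\<phi>\<rangle>\<langle>\<phi>| = \<Sum>\<^sub>f \<langle>f|\<phi>\<rangle>\<langle>\<phi>|f\<rangle>\<close>, with \<open>f\<close> ranging over an orthonormal basis of \<open>Y\<close>:\<close>

definition reduced_density ::
    "'i set \<Rightarrow> 'j set \<Rightarrow> ('j \<Rightarrow> complex) set \<Rightarrow> ('i \<times> 'j \<Rightarrow> complex)
       \<Rightarrow> (('i \<Rightarrow> complex) \<Rightarrow> ('i \<Rightarrow> complex))" where
  "reduced_density I J Y \<phi> x =
     (\<lambda>i. \<Sum>f\<leftarrow>some_onb J Y. partial_inner J f \<phi> i * cinner I (partial_inner J f \<phi>) x)"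

definition entanglement ::
    "'i set \<Rightarrow> 'j set \<Rightarrow> ('i \<Rightarrow> complex) set \<Rightarrow> ('j \<Rightarrow> complex) set \<Rightarrow> ('i \<times> 'j \<Rightarrow> complex)
       \<Rightarrow> real" where
  "entanglement I J X Y \<phi> = von_neumann_entropy I X (reduced_density I J Y \<phi>)"


definition SU2 :: "(complex^2^2) set" where
  "SU2 = {g. g ** (\<chi> i j. cnj (g $ j $ i)) = mat 1 \<and> det g = 1}"

text \<open>
  A spin \<open>j\<close> is encoded by the natural number \<open>n = 2j\<close>, and the basis vector \<open>|j,m\<rangle>\<close> by
  \<open>k = j + m \<in> {0..n}\<close>; thus \<open>j - m\<close> is \<open>n - k\<close>, and \<open>-m\<close> corresponds to \<open>n - k\<close>.

  \<open>V\<^sup>j\<close> is realised on homogeneous polynomials of degree \<open>n\<close> in \<open>x, y\<close>, with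
  \<open>|j,m\<rangle> = x\<^sup>k y\<^sup>n\<^sup>-\<^sup>k / sqrt (k! (n - k)!)\<close> and \<open>g\<close> acting by
  \<open>x \<mapsto> g\<^sub>1\<^sub>1 x + g\<^sub>2\<^sub>1 y\<close>, \<open>y \<mapsto> g\<^sub>1\<^sub>2 x + g\<^sub>2\<^sub>2 y\<close>.  The matrix element \<open>\<langle>j,m|g|j,m'\<rangle>\<close> is read off
  after setting \<open>y = 1\<close>.  The lemmas below confirm that this is a unitary representation in
  which \<open>J\<^sup>z\<close> is diagonal and \<open>J\<^sup>+\<close> has its standard non-negative matrix elements.
\<close>

definition wigner_poly :: "nat \<Rightarrow> complex^2^2 \<Rightarrow> nat \<Rightarrow> complex poly" where
  "wigner_poly n g l = [:g $ 2 $ 1, g $ 1 $ 1:] ^ l * [:g $ 2 $ 2, g $ 1 $ 2:] ^ (n - l)"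

definition wigner :: "nat \<Rightarrow> complex^2^2 \<Rightarrow> nat \<Rightarrow> nat \<Rightarrow> complex" where
  "wigner n g k l =
     of_real (sqrt (fact k * fact (n - k) / (fact l * fact (n - l)))) * coeff (wigner_poly n g l) k"

text \<open>
  For a list \<open>ns\<close> of doubled spins: the product basis of \<open>V\<^sup>j\<^sup>1 \<otimes> V\<^sup>j\<^sup>2 \<otimes> \<dots>\<close>, the space itself,
  the diagonal action, and the intertwiners.
\<close>

definition spin_basis :: "nat list \<Rightarrow> nat list set" where
  "spin_basis ns = {ks. length ks = length ns \<and> (\<forall>i<length ns. ks ! i \<le> ns ! i)}"

definition spin_space :: "nat list \<Rightarrow> (nat list \<Rightarrow> complex) set" where
  "spin_space ns = {v. \<forall>ks. ks \<notin> spin_basis ns \<longrightarrow> v ks = 0}"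

definition spin_action ::
    "nat list \<Rightarrow> complex^2^2 \<Rightarrow> (nat list \<Rightarrow> complex) \<Rightarrow> nat list \<Rightarrow> complex" where
  "spin_action ns g v = (\<lambda>ks. if ks \<in> spin_basis ns
     then \<Sum>ls\<in>spin_basis ns. (\<Prod>i<length ns. wigner (ns ! i) g (ks ! i) (ls ! i)) * v ls
     else 0)"

definition intertwiners :: "nat list \<Rightarrow> (nat list \<Rightarrow> complex) set" where
  "intertwiners ns = {v \<in> spin_space ns. \<forall>g\<in>SU2. spin_action ns g v = v}"

text \<open>The contraction \<open>\<langle>j,m|v\<close> on the last tensor factor:\<close>

definition contract_last :: "nat \<Rightarrow> (nat list \<Rightarrow> complex) \<Rightarrow> nat list \<Rightarrow> complex" where
  "contract_last k v = (\<lambda>as. v (as @ [k]))"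

text \<open>
  The gluing map along the edge with doubled spin \<open>n\<close>, in coordinates; the lemmas
  \<open>gluing_product\<close> and \<open>gluing_linear\<close> show that it is the linear map with the prescribed values
  on product vectors.
\<close>

definition gluing ::
    "nat \<Rightarrow> (nat list \<times> nat list \<Rightarrow> complex) \<Rightarrow> nat list \<times> nat list \<Rightarrow> complex" where
  "gluing n \<phi> = (\<lambda>(as, bs).
     1 / of_real (sqrt (real (n + 1))) *
     (\<Sum>k\<le>n. (-1) ^ (n - k) * \<phi> (as @ [k], bs @ [n - k])))"

definition intertwiner_entanglement ::
    "nat list \<Rightarrow> nat list \<Rightarrow> nat \<Rightarrow> (nat list \<times> nat list \<Rightarrow> complex) \<Rightarrow> real" where
  "intertwiner_entanglement js ks n \<psi> =
     entanglement (spin_basis (js @ [n])) (spin_basis (ks @ [n]))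
       (intertwiners (js @ [n])) (intertwiners (ks @ [n])) \<psi>"

definition boundary_entanglement ::
    "nat list \<Rightarrow> nat list \<Rightarrow> nat \<Rightarrow> (nat list \<times> nat list \<Rightarrow> complex) \<Rightarrow> real" where
  "boundary_entanglement js ks n \<psi> =
     entanglement (spin_basis js) (spin_basis ks) (spin_space js) (spin_space ks)
       (normalized (spin_basis js \<times> spin_basis ks) (gluing n \<psi>))"


lemma gluing_product:
  "gluing n (\<lambda>(a, b). u a * v b) = (\<lambda>(as, bs). 1 / of_real (sqrt (real (n + 1))) *
     (\<Sum>k\<le>n. (-1) ^ (n - k) * (contract_last k u as * contract_last (n - k) v bs)))"
  by (simp add: gluing_def contract_last_def)

lemma gluing_linear:
  "gluing n (\<lambda>p. c * \<phi> p + d * \<psi> p) = (\<lambda>p. c * gluing n \<phi> p + d * gluing n \<psi> p)"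
  by (auto simp: gluing_def fun_eq_iff sum_distrib_left sum.distrib algebra_simps)

lemma wigner_fundamental:
  "wigner 1 g 1 1 = g $ 1 $ 1" "wigner 1 g 1 0 = g $ 1 $ 2"
  "wigner 1 g 0 1 = g $ 2 $ 1" "wigner 1 g 0 0 = g $ 2 $ 2"
  by (simp_all add: wigner_def wigner_poly_def)

lemma coeff_linear_mult:
  "coeff ([:a, b:] * q) k = a * coeff q k + (if k = 0 then 0 else b * coeff q (k - 1))"
  for a b :: complex
  by (cases k) (simp_all add: mult_pCons_left)

lemma wigner_poly_mat_one: "wigner_poly n (mat 1) l = monom 1 l"
  by (simp add: wigner_poly_def mat_def monom_altdef flip: one_pCons)

lemma wigner_one: "k \<le> n \<Longrightarrow> l \<le> n \<Longrightarrow> wigner n (mat 1) k l = (if k = l then 1 else 0)"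
  by (simp add: wigner_def wigner_poly_mat_one)

lemma wigner_Jz:
  assumes "k \<le> n" "l \<le> n"
  shows "wigner n (vector [vector [cis (-\<theta>/2), 0], vector [0, cis (\<theta>/2)]]) k l =
     (if k = l then cis (- \<theta> * (real k - real n / 2)) else 0)"
proof -
  have "[:0, a:] = monom a 1" "[:b, 0:] = monom b 0" for a b :: complex
    by (simp_all add: monom_altdef)
  then have "wigner_poly n (vector [vector [cis (-\<theta>/2), 0], vector [0, cis (\<theta>/2)]]) l
      = monom (cis (-\<theta>/2) ^ l * cis (\<theta>/2) ^ (n - l)) l"
    by (simp only: wigner_poly_def vector_2 monom_power mult_monom) simp
  moreover have "cis (-\<theta>/2) ^ l * cis (\<theta>/2) ^ (n - l) = cis (- \<theta> * (real l - real n / 2))"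
    unfolding Complex.DeMoivre cis_mult using assms
    by (intro arg_cong[of _ _ cis]) (simp add: of_nat_diff field_simps)
  ultimately show ?thesis
    by (simp add: wigner_def)
qed

lemma wigner_Jplus:
  assumes "l < n"
  shows "wigner n (vector [vector [1, t], vector [0, 1]]) (Suc l) l
    = of_real (sqrt (real (n - l) * real (l + 1))) * t"
proof -
  have "wigner_poly n (vector [vector [1, t], vector [0, 1]]) l = monom 1 l * [:1, t:] ^ (n - l)"
    by (simp add: wigner_poly_def vector_2 monom_altdef)
  moreover have "coeff ([:1, t:] ^ m) 1 = of_nat m * t" for m
  proof (induction m)
    case (Suc m)
    have "coeff ([:1, t:] ^ m) 0 = 1" by (induction m) (simp_all add: coeff_mult_0)
    with Suc show ?case by (simp add: algebra_simps)
  qed simp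
  ultimately have c: "coeff (wigner_poly n (vector [vector [1, t], vector [0, 1]]) l) (Suc l)
      = of_nat (n - l) * t"
    by (simp add: coeff_monom_mult)
  obtain d where d: "n - l = Suc d" "n - Suc l = d"
    using assms by (metis Suc_diff_Suc)
  have s: "fact (Suc l) * fact d / (fact l * fact (Suc d)) = (real (l + 1) / real (Suc d))"
    by (simp add: field_simps del: of_nat_Suc)
  have "sqrt (real (l + 1) / real (Suc d)) * real (Suc d) = sqrt (real (Suc d) * real (l + 1))"
    by (simp add: real_sqrt_divide real_sqrt_mult real_div_sqrt field_simps del: of_nat_Suc)
  then have "complex_of_real (sqrt (real (l + 1) / real (Suc d))) * of_nat (Suc d)
      = of_real (sqrt (real (Suc d) * real (l + 1)))"
    by (metis of_real_mult of_real_of_nat_eq)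
  then show ?thesis
    unfolding wigner_def c d s by (metis mult.assoc)
qed

lemma wigner_poly_Suc:
  "wigner_poly (Suc n) g l =
     (if l \<le> n then [:g $ 2 $ 2, g $ 1 $ 2:] * wigner_poly n g l
      else [:g $ 2 $ 1, g $ 1 $ 1:] * wigner_poly n g n)" if "l \<le> Suc n"
  using that
  by (auto simp: wigner_poly_def Suc_diff_le le_Suc_eq mult_ac simp del: mult_pCons_left mult_pCons_right)

lemma degree_wigner_poly: "l \<le> n \<Longrightarrow> degree (wigner_poly n g l) \<le> n"
proof -
  assume "l \<le> n"
  have "degree ([:a, b:] ^ m) \<le> m" for a b :: complex and m
    by (rule order_trans[OF degree_power_le]) simp
  then have "degree (wigner_poly n g l) \<le> l + (n - l)"
    unfolding wigner_poly_def by (intro order_trans[OF degree_mult_le] add_mono)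
  with \<open>l \<le> n\<close> show ?thesis by simp
qed

lemma homogeneous_mult:
  fixes U W q :: "complex poly"
  assumes "degree q \<le> n"
  shows "(smult a U + smult b W) * (\<Sum>p\<le>n. smult (coeff q p) (U ^ p * W ^ (n - p)))
     = (\<Sum>p\<le>Suc n. smult (coeff ([:b, a:] * q) p) (U ^ p * W ^ (Suc n - p)))"
proof -
  have "(\<Sum>p\<le>Suc n. smult (coeff ([:b, a:] * q) p) (U ^ p * W ^ (Suc n - p)))
     = (\<Sum>p\<le>Suc n. smult (b * coeff q p) (U ^ p * W ^ (Suc n - p)))
     + (\<Sum>p\<le>Suc n. smult (if p = 0 then 0 else a * coeff q (p - 1)) (U ^ p * W ^ (Suc n - p)))"
    by (simp only: coeff_linear_mult smult_add_left sum.distrib)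
  also have "(\<Sum>p\<le>Suc n. smult (b * coeff q p) (U ^ p * W ^ (Suc n - p)))
     = (\<Sum>p\<le>n. smult (b * coeff q p) (U ^ p * W ^ (Suc n - p)))"
    using assms by (simp add: coeff_eq_0)
  also have "\<dots> = smult b W * (\<Sum>p\<le>n. smult (coeff q p) (U ^ p * W ^ (n - p)))"
    unfolding sum_distrib_left by (intro sum.cong) (auto simp: Suc_diff_le mult_ac)
  also have "(\<Sum>p\<le>Suc n. smult (if p = 0 then 0 else a * coeff q (p - 1)) (U ^ p * W ^ (Suc n - p)))
     = smult a U * (\<Sum>p\<le>n. smult (coeff q p) (U ^ p * W ^ (n - p)))"
    unfolding sum_distrib_left
    by (subst sum.atMost_Suc_shift) (auto intro!: sum.cong simp: mult_ac)
  finally show ?thesis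
    by (simp add: algebra_simps)
qed

lemma wigner_poly_mult:
  "l \<le> n \<Longrightarrow> wigner_poly n (g ** h) l =
     (\<Sum>p\<le>n. smult (coeff (wigner_poly n h l) p) (wigner_poly n g p))"
proof (induction n arbitrary: l)
  case 0
  then show ?case by (simp add: wigner_poly_def)
next
  case (Suc n)
  define U where "U = [:g $ 2 $ 1, g $ 1 $ 1:]"
  define W where "W = [:g $ 2 $ 2, g $ 1 $ 2:]"
  have gh: "[:(g ** h) $ 2 $ i, (g ** h) $ 1 $ i:] = smult (h $ 1 $ i) U + smult (h $ 2 $ i) W" for i
    by (simp add: U_def W_def matrix_matrix_mult_def sum_2 algebra_simps)
  have step: "[:(g ** h) $ 2 $ i, (g ** h) $ 1 $ i:] * wigner_poly n (g ** h) l'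
     = (\<Sum>p\<le>Suc n. smult (coeff ([:h $ 2 $ i, h $ 1 $ i:] * wigner_poly n h l') p)
          (wigner_poly (Suc n) g p))" if "l' \<le> n" for i l'
    unfolding gh Suc.IH[OF that]
    using homogeneous_mult[OF degree_wigner_poly[OF that], of "h $ 1 $ i" U "h $ 2 $ i" W h]
    by (simp add: wigner_poly_def U_def W_def)
  show ?case
    using step[of l 2] step[of n 1] Suc.prems by (simp only: wigner_poly_Suc[OF Suc.prems] order_refl split: if_split) simp
qed

lemma wigner_mult:
  assumes "k \<le> n" "l \<le> n"
  shows "wigner n (g ** h) k l = (\<Sum>p\<le>n. wigner n g k p * wigner n h p l)"
proof -
  have s: "sqrt (fact k * fact (n - k) / (fact l * fact (n - l)))
    = sqrt (fact k * fact (n - k) / (fact p * fact (n - p)))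
      * sqrt (fact p * fact (n - p) / (fact l * fact (n - l)))" for p
    by (simp flip: real_sqrt_mult)
  have "wigner n (g ** h) k l = (\<Sum>p\<le>n. of_real (sqrt (fact k * fact (n - k) / (fact l * fact (n - l))))
      * (coeff (wigner_poly n h l) p * coeff (wigner_poly n g p) k))"
    by (simp add: wigner_def wigner_poly_mult assms coeff_sum sum_distrib_left)
  also have "\<dots> = (\<Sum>p\<le>n. wigner n g k p * wigner n h p l)"
  proof (rule sum.cong)
    fix p
    show "complex_of_real (sqrt (fact k * fact (n - k) / (fact l * fact (n - l))))
        * (coeff (wigner_poly n h l) p * coeff (wigner_poly n g p) k) = wigner n g k p * wigner n h p l"
      unfolding s[of p] wigner_def of_real_mult by (simp only: mult_ac)
  qed simp
  finally show ?thesis .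
qed

lemma wigner_poly_adjoint:
  "of_nat (n choose l) * coeff (wigner_poly n g l) k =
     cnj (of_nat (n choose k) * coeff (wigner_poly n (\<chi> i j. cnj (g $ j $ i)) k) l)"
proof (induction n arbitrary: k l)
  case 0
  then show ?case by (cases k; cases l) (simp_all add: wigner_poly_def)
next
  case (Suc n)
  let ?F = "\<lambda>h l k. of_nat (n choose l) * coeff (wigner_poly n h l) k"
  have rec: "of_nat (Suc n choose l) * coeff (wigner_poly (Suc n) h l) k =
      h $ 2 $ 2 * ?F h l k + (if k = 0 then 0 else h $ 1 $ 2 * ?F h l (k - 1)) +
      (if l = 0 then 0 else h $ 2 $ 1 * ?F h (l - 1) k
         + (if k = 0 then 0 else h $ 1 $ 1 * ?F h (l - 1) (k - 1)))" for h l k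
  proof -
    have A: "smult (of_nat (n choose l)) (wigner_poly (Suc n) h l)
        = smult (of_nat (n choose l)) ([:h $ 2 $ 2, h $ 1 $ 2:] * wigner_poly n h l)"
      by (cases "l \<le> n") (simp_all add: wigner_poly_Suc binomial_eq_0)
    have B: "wigner_poly (Suc n) h l = [:h $ 2 $ 1, h $ 1 $ 1:] * wigner_poly n h (l - 1)" if "l \<noteq> 0"
      using that by (cases l)
        (simp_all add: wigner_poly_def mult.assoc del: mult_pCons_left mult_pCons_right)
    have "smult (of_nat (Suc n choose l)) (wigner_poly (Suc n) h l)
        = smult (of_nat (n choose l)) (wigner_poly (Suc n) h l)
        + (if l = 0 then 0 else smult (of_nat (n choose (l - 1))) (wigner_poly (Suc n) h l))"
      by (cases l) (simp_all add: add.commute flip: smult_add_left)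
    also have "\<dots> = smult (of_nat (n choose l)) ([:h $ 2 $ 2, h $ 1 $ 2:] * wigner_poly n h l)
        + (if l = 0 then 0
           else smult (of_nat (n choose (l - 1))) ([:h $ 2 $ 1, h $ 1 $ 1:] * wigner_poly n h (l - 1)))"
      using A B by simp
    finally have "coeff (smult (of_nat (Suc n choose l)) (wigner_poly (Suc n) h l)) k = coeff \<dots> k"
      by simp
    then show ?thesis
      by (simp only: coeff_smult coeff_add coeff_linear_mult if_distrib[of "\<lambda>p. coeff p k"] coeff_0)
        (auto simp: algebra_simps)
  qed
  show ?case
    unfolding rec by (cases k; cases l) (simp_all add: Suc.IH del: binomial_n_0)
qed

lemma wigner_adjoint:
  assumes "k \<le> n" "l \<le> n"
  shows "wigner n (\<chi> i j. cnj (g $ j $ i)) l k = cnj (wigner n g k l)"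
proof -
  let ?r = "\<lambda>k. fact k * fact (n - k) :: real"
  have s: "sqrt (?r k / ?r l) = sqrt (?r k * ?r l) / fact n * real (n choose l)"
    if "l \<le> n" for k l
    using that by (simp add: binomial_fact real_sqrt_divide real_sqrt_mult real_div_sqrt field_simps)
  have w: "wigner n h k l = of_real (sqrt (?r k * ?r l) / fact n) *
       (of_nat (n choose l) * coeff (wigner_poly n h l) k)" if "l \<le> n" for h k l
    unfolding wigner_def s[OF that] by simp
  show ?thesis
    unfolding w[OF assms(1)] w[OF assms(2)] wigner_poly_adjoint[of n l g k]
    by (simp add: mult_ac)
qed

lemma wigner_unitary:
  assumes "g \<in> SU2" "k \<le> n" "l \<le> n"
  shows "(\<Sum>p\<le>n. wigner n g k p * cnj (wigner n g l p)) = (if k = l then 1 else 0)"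
proof -
  have "(\<Sum>p\<le>n. wigner n g k p * cnj (wigner n g l p))
      = wigner n (g ** (\<chi> i j. cnj (g $ j $ i))) k l"
    using assms by (simp add: wigner_mult wigner_adjoint)
  with assms show ?thesis
    by (simp add: SU2_def wigner_one)
qed

end

(* By Schur's lemma, contracting orthonormal intertwiners with <j,m| gives vectors of squared norm
   1/(2j+1) that are orthogonal for different m.  Applied to the B side, this shows that the reduced
   density operator of the glued state is the partial trace over V^j of the reduced density operator
   of the intertwiner state; applied to the A side, that the contractions of an eigenvector with
   eigenvalue p give 2j+1 orthogonal eigenvectors with eigenvalue p/(2j+1).  The entropy therefore
   grows by ln(2j+1). *)
theory Submission
  imports Defs "Jordan_Normal_Form.Spectral_Radius"
begin

no_notation vec_index (infixl "$" 100)

subsection \<open>Orthonormal lists\<close>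

text \<open>The entropy is defined through arbitrary choices: \<open>some_onb\<close> picks the
  bases for the traces and \<open>op_fun\<close> picks an eigenbasis. The eigenvectors found by
  contraction cannot be assumed to be the chosen ones, and in general they do not even span the
  boundary space. An unknown complete eigenbasis must therefore be compared with an explicit
  incomplete one. Two devices make this possible: density operators are written as Gram matrices of
  slices, which mention no basis, and spectral sums of a function vanishing at 0 are shown to depend
  on the operator alone. Invariance enters only through Schur's lemma, which is derived from
  explicit matrix elements: diagonal group elements and one rotation suffice, without integration
  over the group. The glued vector has norm 1/(2j+1): in its squared norm one factor 1/(2j+1) is the
  normalization of the gluing map, the other the squared norm of a contracted unit
  intertwiner.\<close>

definition subspace_on :: "'i set \<Rightarrow> ('i \<Rightarrow> complex) set \<Rightarrow> bool" where
  "subspace_on I X \<longleftrightarrow> (\<lambda>i. 0) \<in> X \<and>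
     (\<forall>x\<in>X. \<forall>y\<in>X. \<forall>c d. (\<lambda>i. c * x i + d * y i) \<in> X) \<and> (\<forall>x\<in>X. \<forall>i. i \<notin> I \<longrightarrow> x i = 0)"

definition orthonormal_list :: "'i set \<Rightarrow> ('i \<Rightarrow> complex) list \<Rightarrow> bool" where
  "orthonormal_list I es \<longleftrightarrow>
     (\<forall>a<length es. \<forall>b<length es. cinner I (es ! a) (es ! b) = (if a = b then 1 else 0))"

lemma cnj_cinner: "cnj (cinner I x y) = cinner I y x"
  by (simp add: cinner_def mult.commute)

lemma cinner_add_right: "cinner I x (\<lambda>i. y i + z i) = cinner I x y + cinner I x z"
  by (simp add: cinner_def algebra_simps sum.distrib)

lemma cinner_diff_right: "cinner I x (\<lambda>i. y i - z i) = cinner I x y - cinner I x z"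
  by (simp add: cinner_def algebra_simps sum_subtractf)

lemma cinner_scale_right: "cinner I x (\<lambda>i. c * y i) = c * cinner I x y"
  by (simp add: cinner_def algebra_simps sum_distrib_left)

lemma cinner_sum_right: "cinner I x (\<lambda>i. \<Sum>a\<in>A. c a * y a i) = (\<Sum>a\<in>A. c a * cinner I x (y a))"
  unfolding cinner_def sum_distrib_left
  by (subst sum.swap) (auto intro!: sum.cong simp: algebra_simps)

lemma cinner_scale_left: "cinner I (\<lambda>i. c * y i) x = cnj c * cinner I y x"
  by (simp add: cinner_def algebra_simps sum_distrib_left)

lemma cinner_sum_left: "cinner I (\<lambda>i. \<Sum>a\<in>A. c a * y a i) x = (\<Sum>a\<in>A. cnj (c a) * cinner I (y a) x)"
  using arg_cong[OF cinner_sum_right[of I x c y A], of cnj] by (simp add: cnj_cinner)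

lemma cinner_self: "cinner I x x = of_real (\<Sum>i\<in>I. (cmod (x i))\<^sup>2)"
  by (simp add: cinner_def complex_norm_square mult.commute del: of_real_power)

text \<open>\<open>cinner I\<close> does not see values outside \<open>I\<close>. The support
  condition, also built into \<open>subspace_on\<close>, turns norm zero into an equality of
  functions, the form in which eigenvector equations are stated.\<close>

lemma cinner_self_eq_0:
  assumes "finite I" "cinner I x x = 0" "\<And>i. i \<notin> I \<Longrightarrow> x i = 0"
  shows "x = (\<lambda>i. 0)"
proof
  fix i
  have "(\<Sum>i\<in>I. (cmod (x i))\<^sup>2) = 0"
    using assms(2) unfolding cinner_self by (simp only: of_real_eq_0_iff)
  then have "\<forall>i\<in>I. (cmod (x i))\<^sup>2 = 0"
    by (subst (asm) sum_nonneg_eq_0_iff) (use assms(1) in auto)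
  then show "x i = 0"
    using assms(3)[of i] by (cases "i \<in> I") auto
qed

lemma subspace_on_sum:
  assumes "subspace_on I X" "\<And>a. a \<in> A \<Longrightarrow> y a \<in> X"
  shows "(\<lambda>i. \<Sum>a\<in>A. c a * y a i) \<in> X"
  using assms(2)
proof (induction A rule: infinite_finite_induct)
  case (insert a A)
  have lin: "\<forall>x\<in>X. \<forall>z\<in>X. \<forall>c d. (\<lambda>i. c * x i + d * z i) \<in> X"
    using assms(1) unfolding subspace_on_def by (elim conjE)
  have "y a \<in> X" "(\<lambda>i. \<Sum>a\<in>A. c a * y a i) \<in> X" using insert by simp_all
  from lin[rule_format, OF this, of "c a" 1]
  have "(\<lambda>i. c a * y a i + 1 * (\<Sum>a\<in>A. c a * y a i)) \<in> X" .
  then show ?case using insert by simp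
qed (use assms(1) in \<open>auto simp: subspace_on_def\<close>)

lemma subspace_on_support: "subspace_on I X \<Longrightarrow> x \<in> X \<Longrightarrow> i \<notin> I \<Longrightarrow> x i = 0"
  by (simp add: subspace_on_def)

lemma subspace_on_scale: "subspace_on I X \<Longrightarrow> x \<in> X \<Longrightarrow> (\<lambda>i. c * x i) \<in> X"
  using subspace_on_sum[of I X "{0::nat}" "\<lambda>_. x" "\<lambda>_. c"] by simp

lemma subspace_on_diff:
  assumes "subspace_on I X" "x \<in> X" "y \<in> X"
  shows "(\<lambda>i. x i - y i) \<in> X"
proof -
  have "(\<lambda>i. 1 * x i + (-1) * y i) \<in> X" using assms unfolding subspace_on_def by blast
  then show ?thesis by simp
qed

lemma cinner_orthonormal_sum:
  assumes "orthonormal_list I es" "a < length es"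
  shows "cinner I (es ! a) (\<lambda>i. \<Sum>b<length es. c b * (es ! b) i) = c a"
proof -
  have "cinner I (es ! a) (\<lambda>i. \<Sum>b<length es. c b * (es ! b) i)
      = (\<Sum>b<length es. if b = a then c b else 0)"
    unfolding cinner_sum_right using assms by (intro sum.cong) (auto simp: orthonormal_list_def)
  then show ?thesis using assms(2) by simp
qed

lemma bessel:
  assumes "orthonormal_list I es"
  shows "(\<Sum>a<length es. (cmod (cinner I (es ! a) x))\<^sup>2) \<le> (\<Sum>i\<in>I. (cmod (x i))\<^sup>2)"
proof -
  define p where "p = (\<lambda>i. \<Sum>a<length es. cinner I (es ! a) x * (es ! a) i)"
  define d where "d = (\<lambda>i. x i - p i)"
  have px: "cinner I p x = of_real (\<Sum>a<length es. (cmod (cinner I (es ! a) x))\<^sup>2)"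
    unfolding p_def cinner_sum_left
    by (simp add: complex_norm_square mult.commute del: of_real_power)
  have ep: "cinner I (es ! a) p = cinner I (es ! a) x" if "a < length es" for a
    unfolding p_def using cinner_orthonormal_sum[OF assms that] .
  have pp: "cinner I p p = cinner I p x"
    unfolding p_def cinner_sum_left
    using ep by (intro sum.cong) (auto simp: p_def)
  have xp: "cinner I x p = cinner I p x"
    by (metis px cnj_cinner complex_cnj_complex_of_real)
  have "cinner I d d = cinner I d x - cinner I d p"
    unfolding d_def by (rule cinner_diff_right)
  also have "\<dots> = cnj (cinner I x x - cinner I x p) - cnj (cinner I p x - cinner I p p)"
    unfolding d_def cinner_diff_right[symmetric] cnj_cinner ..
  also have "\<dots> = cinner I x x - cinner I p x"
    by (simp add: cnj_cinner xp pp)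
  finally have "of_real (\<Sum>i\<in>I. (cmod (d i))\<^sup>2) = complex_of_real ((\<Sum>i\<in>I. (cmod (x i))\<^sup>2)
      - (\<Sum>a<length es. (cmod (cinner I (es ! a) x))\<^sup>2))"
    unfolding px cinner_self of_real_diff .
  then have "(\<Sum>i\<in>I. (cmod (d i))\<^sup>2) = (\<Sum>i\<in>I. (cmod (x i))\<^sup>2)
      - (\<Sum>a<length es. (cmod (cinner I (es ! a) x))\<^sup>2)"
    by (simp only: of_real_eq_iff)
  moreover have "(\<Sum>i\<in>I. (cmod (d i))\<^sup>2) \<ge> 0" by (simp add: sum_nonneg)
  ultimately show ?thesis by linarith
qed

text \<open>Bessel's inequality for the coordinate vector at \<open>i\<close> bounds the sum over
  the list of the squared entries at \<open>i\<close> by 1; summing over \<open>I\<close> then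
  counts every list element once. This takes the place of a dimension argument.\<close>

lemma orthonormal_list_length:
  assumes "finite I" "orthonormal_list I es"
  shows "length es \<le> card I"
proof -
  have "(\<Sum>a<length es. (cmod ((es ! a) i))\<^sup>2) \<le> 1" if "i \<in> I" for i
  proof -
    have "cinner I (es ! a) (\<lambda>k. if k = i then 1 else 0) = cnj ((es ! a) i)" for a
      unfolding cinner_def using that assms(1) by (simp add: if_distrib cong: if_cong)
    moreover have "(\<Sum>k\<in>I. (cmod (if k = i then 1 else 0))\<^sup>2) = (\<Sum>k\<in>I. if k = i then 1 else 0)"
      by (rule sum.cong) auto
    ultimately show ?thesis
      using bessel[OF assms(2), of "\<lambda>k. if k = i then 1 else 0"] that assms(1) by simp
  qed
  then have "(\<Sum>i\<in>I. \<Sum>a<length es. (cmod ((es ! a) i))\<^sup>2) \<le> real (card I)"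
    using sum_bounded_above[of I _ "1::real"] by (simp add: assms)
  moreover have "(\<Sum>i\<in>I. \<Sum>a<length es. (cmod ((es ! a) i))\<^sup>2) = real (length es)"
  proof -
    have "(\<Sum>i\<in>I. (cmod ((es ! a) i))\<^sup>2) = 1" if "a < length es" for a
      using assms(2) that unfolding orthonormal_list_def
      by (metis cinner_self of_real_eq_1_iff)
    then show ?thesis by (subst sum.swap) simp
  qed
  ultimately show ?thesis by linarith
qed

lemma maximal_orthonormal_list:
  assumes "finite I"
  obtains es where "orthonormal_list I es" "set es \<subseteq> S"
    "\<And>x. x \<in> S \<Longrightarrow> cinner I x x = 1 \<Longrightarrow> \<exists>a<length es. cinner I (es ! a) x \<noteq> 0"
proof -
  let ?P = "\<lambda>es. orthonormal_list I es \<and> set es \<subseteq> S"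
  have "?P []" by (simp add: orthonormal_list_def)
  moreover have "\<forall>es. ?P es \<longrightarrow> length es < Suc (card I)"
    using orthonormal_list_length[OF assms] by (auto simp: less_Suc_eq_le)
  ultimately obtain es where es: "?P es" and mx: "\<And>fs. ?P fs \<Longrightarrow> length fs \<le> length es"
    using ex_has_greatest_nat[of ?P "[]" length "Suc (card I)"] by (metis order_less_imp_le)
  have "\<exists>a<length es. cinner I (es ! a) x \<noteq> 0" if x: "x \<in> S" "cinner I x x = 1" for x
  proof (rule ccontr)
    assume "\<not> ?thesis"
    then have o: "cinner I (es ! a) x = 0" "cinner I x (es ! a) = 0" if "a < length es" for a
      using that by (auto simp flip: cnj_cinner[of I "es ! a" x])
    have "?P (es @ [x])"
      using es x o by (auto simp: orthonormal_list_def nth_append less_Suc_eq)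
    from mx[OF this] show False by simp
  qed
  with es that show ?thesis by blast
qed

lemma normalize_in_subspace:
  assumes "finite I" "subspace_on I X" "x \<in> X" "x \<noteq> (\<lambda>i. 0)"
  obtains c where "cinner I (\<lambda>i. c * x i) (\<lambda>i. c * x i) = 1"
proof -
  define s where "s = (\<Sum>i\<in>I. (cmod (x i))\<^sup>2)"
  have "s \<ge> 0" by (simp add: s_def sum_nonneg)
  moreover have "s \<noteq> 0"
    using cinner_self_eq_0[OF assms(1), of x] assms(2-4)
    by (auto simp: cinner_self s_def subspace_on_def simp del: of_real_sum)
  ultimately have "s > 0" by simp
  then have "cinner I (\<lambda>i. of_real (1 / sqrt s) * x i) (\<lambda>i. of_real (1 / sqrt s) * x i) = 1"
    unfolding cinner_scale_left cinner_scale_right cinner_self s_def[symmetric]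
    by (simp flip: of_real_mult)
  then show ?thesis by (rule that)
qed

lemma orthonormal_basisI:
  assumes "finite I" "subspace_on I X" "orthonormal_list I es" "set es \<subseteq> X"
    and max: "\<And>x. x \<in> X \<Longrightarrow> (\<forall>a<length es. cinner I (es ! a) x = 0) \<Longrightarrow> x = (\<lambda>i. 0)"
  shows "orthonormal_basis I X es"
  unfolding orthonormal_basis_def
proof (intro conjI ballI)
  show "set es \<subseteq> X" by fact
  show "\<forall>a<length es. \<forall>b<length es. cinner I (es ! a) (es ! b) = (if a = b then 1 else 0)"
    using assms(3) by (simp add: orthonormal_list_def)
  fix x assume x: "x \<in> X"
  define p where "p = (\<lambda>i. \<Sum>a<length es. cinner I (es ! a) x * (es ! a) i)"
  have "p \<in> X" unfolding p_def using assms(4) by (intro subspace_on_sum[OF assms(2)]) auto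
  then have "(\<lambda>i. x i - p i) \<in> X" using subspace_on_diff[OF assms(2) x] by blast
  moreover have "\<forall>a<length es. cinner I (es ! a) (\<lambda>i. x i - p i) = 0"
    unfolding cinner_diff_right p_def using cinner_orthonormal_sum[OF assms(3)] by simp
  ultimately have "(\<lambda>i. x i - p i) = (\<lambda>i. 0)" by (rule max)
  then have "x = p" by (simp add: fun_eq_iff)
  then show "\<exists>c. x = (\<lambda>i. \<Sum>a<length es. c a * (es ! a) i)" unfolding p_def by (rule exI[where x = "\<lambda>a. cinner I (es ! a) x"])
qed

lemma orthonormal_basis_exists:
  assumes "finite I" "subspace_on I X"
  obtains es where "orthonormal_basis I X es"
proof -
  obtain es where es: "orthonormal_list I es" "set es \<subseteq> X"
    "\<And>x. x \<in> X \<Longrightarrow> cinner I x x = 1 \<Longrightarrow> \<exists>a<length es. cinner I (es ! a) x \<noteq> 0"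
    using maximal_orthonormal_list[OF assms(1), of X] by blast
  have "x = (\<lambda>i. 0)" if x: "x \<in> X" "\<forall>a<length es. cinner I (es ! a) x = 0" for x
  proof (rule ccontr)
    assume "x \<noteq> (\<lambda>i. 0)"
    then obtain c where "cinner I (\<lambda>i. c * x i) (\<lambda>i. c * x i) = 1"
      using normalize_in_subspace[OF assms x(1)] by blast
    from es(3)[OF subspace_on_scale[OF assms(2) x(1)] this] show False
      using x(2) by (auto simp: cinner_scale_right)
  qed
  from orthonormal_basisI[OF assms es(1,2) this] that show ?thesis by blast
qed

lemma orthonormal_basis_list: "orthonormal_basis I X es \<Longrightarrow> orthonormal_list I es"
  by (simp add: orthonormal_basis_def orthonormal_list_def)

lemma orthonormal_basis_expansion:
  assumes "orthonormal_basis I X es" "x \<in> X"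
  shows "x = (\<lambda>i. \<Sum>a<length es. cinner I (es ! a) x * (es ! a) i)"
proof -
  obtain c where c: "x = (\<lambda>i. \<Sum>a<length es. c a * (es ! a) i)"
    using assms unfolding orthonormal_basis_def by blast
  have "cinner I (es ! a) x = c a" if "a < length es" for a
    unfolding c using cinner_orthonormal_sum[OF orthonormal_basis_list[OF assms(1)] that] .
  with c show ?thesis by (simp add: fun_eq_iff)
qed

lemma parseval:
  assumes "orthonormal_basis I X es" "x \<in> X"
  shows "cinner I y x = (\<Sum>a<length es. cinner I y (es ! a) * cinner I (es ! a) x)"
proof -
  have "cinner I y x = cinner I y (\<lambda>i. \<Sum>a<length es. cinner I (es ! a) x * (es ! a) i)"
    using orthonormal_basis_expansion[OF assms] by simp
  also have "\<dots> = (\<Sum>a<length es. cinner I (es ! a) x * cinner I y (es ! a))"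
    by (rule cinner_sum_right)
  finally show ?thesis by (simp add: mult.commute)
qed

subsection \<open>Spectral decomposition and entropy\<close>

text \<open>The matrix is indexed by the coordinates of the ambient space, not by a basis of a
  subspace, so that a reduced density operator gets a closed form free of chosen bases.\<close>

definition kernel_op :: "'i set \<Rightarrow> ('i \<Rightarrow> 'i \<Rightarrow> complex) \<Rightarrow> ('i \<Rightarrow> complex) \<Rightarrow> 'i \<Rightarrow> complex" where
  "kernel_op I R x = (\<lambda>i. \<Sum>k\<in>I. R i k * x k)"

definition hermitian_kernel :: "('i \<Rightarrow> 'i \<Rightarrow> complex) \<Rightarrow> bool" where
  "hermitian_kernel R \<longleftrightarrow> (\<forall>i k. R i k = cnj (R k i))"

lemma kernel_op_sum: "kernel_op I R (\<lambda>i. \<Sum>a\<in>A. c a * y a i) = (\<lambda>i. \<Sum>a\<in>A. c a * kernel_op I R (y a) i)"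
  unfolding kernel_op_def sum_distrib_left
  by (subst sum.swap) (auto intro!: sum.cong simp: algebra_simps)

lemma kernel_op_scale: "kernel_op I R (\<lambda>i. c * y i) = (\<lambda>i. c * kernel_op I R y i)"
  by (auto simp: kernel_op_def sum_distrib_left algebra_simps)

lemma kernel_op_selfadjoint:
  assumes "hermitian_kernel R"
  shows "cinner I x (kernel_op I R y) = cinner I (kernel_op I R x) y"
proof -
  have "cinner I x (kernel_op I R y) = (\<Sum>k\<in>I. \<Sum>i\<in>I. cnj (x i) * (R i k * y k))"
    unfolding cinner_def kernel_op_def sum_distrib_left by (rule sum.swap)
  also have "\<dots> = (\<Sum>k\<in>I. \<Sum>i\<in>I. cnj (R k i * x i) * y k)"
  proof (intro sum.cong refl)
    fix i k
    have "R i k = cnj (R k i)" using assms unfolding hermitian_kernel_def by blast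
    then show "cnj (x i) * (R i k * y k) = cnj (R k i * x i) * y k" by simp
  qed
  finally show ?thesis
    unfolding cinner_def kernel_op_def by (simp add: sum_distrib_right)
qed

text \<open>Compressing the operator to an orthonormal basis of \<open>X\<close> gives a complex
  square matrix of positive size, which has an eigenvalue. Self-adjointness makes it real.\<close>

lemma hermitian_eigenvector_exists:
  assumes I: "finite I" and X: "subspace_on I X" and ne: "x0 \<in> X" "x0 \<noteq> (\<lambda>i. 0)"
    and herm: "hermitian_kernel R"
    and inv: "\<And>x. x \<in> X \<Longrightarrow> kernel_op I R x \<in> X"
  obtains x p where "x \<in> X" "cinner I x x = 1" "kernel_op I R x = (\<lambda>i. complex_of_real p * x i)"
proof -
  obtain es where es: "orthonormal_basis I X es"
    using orthonormal_basis_exists[OF I X] .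
  let ?n = "length es"
  have "?n \<noteq> 0"
    using orthonormal_basis_expansion[OF es ne(1)] ne(2) by auto
  define A where "A = mat ?n ?n (\<lambda>(a, b). cinner I (es ! a) (kernel_op I R (es ! b)))"
  have A: "A \<in> carrier_mat ?n ?n" by (simp add: A_def)
  obtain c where "eigenvalue A c"
    using spectrum_non_empty[OF A] \<open>?n \<noteq> 0\<close> by (auto simp: spectrum_def)
  then obtain v where v: "v \<in> carrier_vec ?n" "v \<noteq> 0\<^sub>v ?n" "A *\<^sub>v v = c \<cdot>\<^sub>v v"
    unfolding eigenvalue_def eigenvector_def using A by auto
  define x where "x = (\<lambda>i. \<Sum>b<?n. vec_index v b * (es ! b) i)"
  have esX: "es ! b \<in> X" if "b < ?n" for b
    using es that unfolding orthonormal_basis_def by auto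
  have xX: "x \<in> X" unfolding x_def by (rule subspace_on_sum[OF X]) (use esX in auto)
  have ex: "cinner I (es ! a) x = vec_index v a" if "a < ?n" for a
    unfolding x_def using cinner_orthonormal_sum[OF orthonormal_basis_list[OF es] that] .
  have "x \<noteq> (\<lambda>i. 0)"
  proof
    assume "x = (\<lambda>i. 0)"
    then have "vec_index v a = 0" if "a < ?n" for a using ex[OF that] by (simp add: cinner_def)
    then have "v = 0\<^sub>v ?n" using v(1) by (intro eq_vecI) auto
    with v(2) show False by simp
  qed
  have eig: "cinner I (es ! a) (kernel_op I R x) = c * vec_index v a" if "a < ?n" for a
  proof -
    have "c * vec_index v a = vec_index (A *\<^sub>v v) a"
      using v that by simp
    also have "\<dots> = (\<Sum>b<?n. cinner I (es ! a) (kernel_op I R (es ! b)) * vec_index v b)"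
      using that v(1) by (simp add: A_def scalar_prod_def atLeast0LessThan)
    finally show ?thesis
      unfolding x_def kernel_op_sum cinner_sum_right by (simp add: mult.commute)
  qed
  \<comment> \<open>By invariance the image of \<open>x\<close> stays in \<open>X\<close>, so its
    coordinates in \<open>es\<close> determine it and the compression loses nothing.\<close>
  have Tx: "kernel_op I R x = (\<lambda>i. c * x i)"
  proof -
    have "kernel_op I R x = (\<lambda>i. \<Sum>a<?n. cinner I (es ! a) (kernel_op I R x) * (es ! a) i)"
      by (rule orthonormal_basis_expansion[OF es inv[OF xX]])
    also have "\<dots> = (\<lambda>i. \<Sum>a<?n. c * vec_index v a * (es ! a) i)"
      by (simp add: eig)
    finally show ?thesis by (simp add: x_def sum_distrib_left mult.assoc)
  qed
  obtain d where d: "cinner I (\<lambda>i. d * x i) (\<lambda>i. d * x i) = 1"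
    using normalize_in_subspace[OF I X xX \<open>x \<noteq> (\<lambda>i. 0)\<close>] .
  define y where "y = (\<lambda>i. d * x i)"
  have Ty: "kernel_op I R y = (\<lambda>i. c * y i)"
    unfolding y_def kernel_op_scale Tx by (auto simp: algebra_simps)
  have "c = cnj c"
    using kernel_op_selfadjoint[OF herm, of I y y] d
    unfolding Ty cinner_scale_left cinner_scale_right d[folded y_def] by simp
  then have "c = of_real (Re c)" by (simp add: complex_eq_iff)
  then have "kernel_op I R y = (\<lambda>i. complex_of_real (Re c) * y i)" using Ty by simp
  moreover have "y \<in> X" unfolding y_def by (rule subspace_on_scale[OF X xX])
  ultimately show ?thesis using d that unfolding y_def by blast
qed

text \<open>A maximal orthonormal list of eigenvectors is complete: by self-adjointness its
  orthogonal complement \<open>Z\<close> in \<open>X\<close> is invariant, so a nonzero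
  \<open>Z\<close> would contain a further unit eigenvector.\<close>

lemma spectral_decomposition_exists:
  assumes I: "finite I" and X: "subspace_on I X"
    and herm: "hermitian_kernel R"
    and inv: "\<And>x. x \<in> X \<Longrightarrow> kernel_op I R x \<in> X"
  obtains es ps where "spectral_decomposition I X (kernel_op I R) es ps"
proof -
  let ?T = "kernel_op I R"
  define S where "S = {x \<in> X. \<exists>p. ?T x = (\<lambda>i. complex_of_real p * x i)}"
  obtain es where es: "orthonormal_list I es" "set es \<subseteq> S"
    "\<And>x. x \<in> S \<Longrightarrow> cinner I x x = 1 \<Longrightarrow> \<exists>a<length es. cinner I (es ! a) x \<noteq> 0"
    using maximal_orthonormal_list[OF I, of S] by blast
  have "\<exists>p. ?T (es ! a) = (\<lambda>i. complex_of_real p * (es ! a) i)" if "a < length es" for a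
  proof -
    have "es ! a \<in> S" using es(2) that by auto
    then show ?thesis by (simp add: S_def)
  qed
  then obtain p where p: "\<And>a. a < length es \<Longrightarrow> ?T (es ! a) = (\<lambda>i. complex_of_real (p a) * (es ! a) i)"
    by metis
  define Z where "Z = {x \<in> X. \<forall>a<length es. cinner I (es ! a) x = 0}"
  have Z: "subspace_on I Z"
    using X unfolding subspace_on_def Z_def
    by (auto simp: cinner_add_right cinner_scale_right) (simp add: cinner_def)
  have Zinv: "?T x \<in> Z" if "x \<in> Z" for x
    using that inv unfolding Z_def
    by (auto simp: kernel_op_selfadjoint[OF herm] p cinner_scale_left)
  have "x = (\<lambda>i. 0)" if x: "x \<in> X" "\<forall>a<length es. cinner I (es ! a) x = 0" for x
  proof (rule ccontr)
    assume "x \<noteq> (\<lambda>i. 0)"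
    then obtain y q where "y \<in> Z" "cinner I y y = 1" "?T y = (\<lambda>i. complex_of_real q * y i)"
      using hermitian_eigenvector_exists[OF I Z _ _ herm Zinv] x by (auto simp: Z_def)
    with es(3)[of y] show False by (auto simp: S_def Z_def)
  qed
  then have "orthonormal_basis I X es"
    using es by (intro orthonormal_basisI[OF I X]) (auto simp: S_def)
  then have "spectral_decomposition I X ?T es (map p [0..<length es])"
    unfolding spectral_decomposition_def using p by simp
  then show ?thesis by (rule that)
qed

text \<open>The squared overlaps of two eigenbases form a doubly stochastic matrix linking only
  equal eigenvalues; if one of the families spans merely the range of the operator, what is
  missing are eigenvectors for the eigenvalue 0.\<close>

lemma spectral_sum_unique:
  fixes u :: "'c \<Rightarrow> 'i \<Rightarrow> complex" and r :: "'c \<Rightarrow> real" and h :: "real \<Rightarrow> real"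
  assumes sd: "spectral_decomposition I X T es ps" and C: "finite C"
    and uX: "\<And>c. c \<in> C \<Longrightarrow> u c \<in> X"
    and on: "\<And>c d. c \<in> C \<Longrightarrow> d \<in> C \<Longrightarrow> cinner I (u c) (u d) = (if c = d then 1 else 0)"
    and T: "\<And>x. x \<in> X \<Longrightarrow> T x = (\<lambda>i. \<Sum>c\<in>C. (of_real (r c) * cinner I (u c) x) * u c i)"
    and h0: "h 0 = 0"
  shows "(\<Sum>a<length es. h (ps ! a)) = (\<Sum>c\<in>C. h (r c))"
proof -
  have es: "orthonormal_basis I X es"
    and Te: "\<And>a. a < length es \<Longrightarrow> T (es ! a) = (\<lambda>i. of_real (ps ! a) * (es ! a) i)"
    using sd by (auto simp: spectral_decomposition_def)
  have esX: "es ! a \<in> X" if "a < length es" for a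
    using es that unfolding orthonormal_basis_def by auto
  define w where "w c a = (cmod (cinner I (u c) (es ! a)))\<^sup>2" for c a
  have wc: "of_real (w c a) = cinner I (es ! a) (u c) * cinner I (u c) (es ! a)" for c a
    unfolding w_def complex_norm_square cnj_cinner by (rule mult.commute)
  \<comment> \<open>Evaluating the inner product of \<open>u c\<close> with
    \<open>T (es ! a)\<close> in two ways shows that overlapping eigenvectors share their
    eigenvalue.\<close>
  have eq: "w c a = 0 \<or> ps ! a = r c" if "c \<in> C" "a < length es" for c a
  proof -
    have "cinner I (u c) (T (es ! a)) = (\<Sum>d\<in>C. if d = c then of_real (r c) * cinner I (u c) (es ! a) else 0)"
      unfolding T[OF esX[OF that(2)]] cinner_sum_right
      by (rule sum.cong) (use on that in auto)
    then have "of_real (ps ! a) * cinner I (u c) (es ! a) = of_real (r c) * cinner I (u c) (es ! a)"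
      unfolding Te[OF that(2)] cinner_scale_right using C that by simp
    then show ?thesis by (auto simp: w_def)
  qed
  have row: "(\<Sum>a<length es. w c a) = 1" if "c \<in> C" for c
  proof -
    have "complex_of_real (\<Sum>a<length es. w c a) = cinner I (u c) (u c)"
      unfolding of_real_sum wc using parseval[OF es uX[OF that], of "u c"] by (simp add: mult.commute)
    then show ?thesis using on that by (metis of_real_eq_1_iff)
  qed
  have col: "(\<Sum>c\<in>C. w c a) = 1" if "ps ! a \<noteq> 0" and a: "a < length es" for a
  proof -
    have "cinner I (es ! a) (es ! a) = 1"
      using es a by (simp add: orthonormal_basis_def)
    then have "complex_of_real (ps ! a) = cinner I (es ! a) (T (es ! a))"
      unfolding Te[OF a] cinner_scale_right by simp
    also have "\<dots> = of_real (\<Sum>c\<in>C. r c * w c a)"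
      unfolding T[OF esX[OF a]] cinner_sum_right of_real_sum of_real_mult wc
      by (simp add: algebra_simps)
    also have "(\<Sum>c\<in>C. r c * w c a) = (\<Sum>c\<in>C. ps ! a * w c a)"
      by (rule sum.cong) (use eq a in force)+
    finally have "ps ! a = ps ! a * (\<Sum>c\<in>C. w c a)"
      by (simp only: of_real_eq_iff sum_distrib_left)
    then show ?thesis using that by simp
  qed
  have "(\<Sum>c\<in>C. h (r c)) = (\<Sum>c\<in>C. \<Sum>a<length es. w c a * h (r c))"
    by (simp flip: sum_distrib_right add: row)
  also have "\<dots> = (\<Sum>c\<in>C. \<Sum>a<length es. w c a * h (ps ! a))"
    by (intro sum.cong) (use eq in force)+
  also have "\<dots> = (\<Sum>a<length es. (\<Sum>c\<in>C. w c a) * h (ps ! a))"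
    by (subst sum.swap) (simp add: sum_distrib_right)
  \<comment> \<open>Columns with eigenvalue 0 have an unknown sum, but their weight is
    \<open>h 0\<close>, which is 0.\<close>
  also have "\<dots> = (\<Sum>a<length es. h (ps ! a))"
    by (intro sum.cong) (use col h0 in force)+
  finally show ?thesis ..
qed

text \<open>The given decomposition only shows that the choice made in \<open>op_fun\<close>
  succeeds; the obtained one is the chosen one. The trace runs over an unrelated basis
  \<open>fs\<close>, in which Parseval gives every eigenprojection trace 1.\<close>

lemma von_neumann_entropy_spectral:
  assumes sd: "spectral_decomposition I X (kernel_op I R) es0 ps0"
  obtains es ps where "spectral_decomposition I X (kernel_op I R) es ps"
    "von_neumann_entropy I X (kernel_op I R) = - (\<Sum>a<length es. ps ! a * ln (ps ! a))"
proof -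
  let ?T = "kernel_op I R"
  obtain es ps where ep: "(SOME (es, ps). spectral_decomposition I X ?T es ps) = (es, ps)"
    by (cases "(SOME (es, ps). spectral_decomposition I X ?T es ps)") auto
  have sp: "spectral_decomposition I X ?T es ps"
    using someI[of "\<lambda>(es, ps). spectral_decomposition I X ?T es ps" "(es0, ps0)"] sd ep by simp
  define fs where "fs = some_onb I X"
  have fs: "orthonormal_basis I X fs"
    using sd someI[of "orthonormal_basis I X" es0] unfolding fs_def some_onb_def spectral_decomposition_def by blast
  have es: "orthonormal_basis I X es"
    and Te: "\<And>a. a < length es \<Longrightarrow> ?T (es ! a) = (\<lambda>i. of_real (ps ! a) * (es ! a) i)"
    using sp by (auto simp: spectral_decomposition_def)
  have esX: "es ! a \<in> X" if "a < length es" for a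
    using es that unfolding orthonormal_basis_def by auto
  have tr: "cinner I f (?T (op_fun I X ln ?T f))
      = (\<Sum>a<length es. of_real (ps ! a * ln (ps ! a)) * (cinner I (es ! a) f * cinner I f (es ! a)))" for f
    unfolding op_fun_def ep Let_def prod.case kernel_op_sum cinner_sum_right
    by (rule sum.cong) (simp_all add: Te cinner_scale_right)
  have "op_trace I X (\<lambda>x. ?T (op_fun I X ln ?T x))
      = (\<Sum>b<length fs. \<Sum>a<length es. of_real (ps ! a * ln (ps ! a)) * (cinner I (es ! a) (fs ! b) * cinner I (fs ! b) (es ! a)))"
    unfolding op_trace_def fs_def[symmetric] tr by (simp add: sum_list_sum_nth atLeast0LessThan)
  also have "\<dots> = (\<Sum>a<length es. of_real (ps ! a * ln (ps ! a)) * cinner I (es ! a) (es ! a))"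
  proof (subst sum.swap, rule sum.cong)
    fix a assume "a \<in> {..<length es}"
    then have "cinner I (es ! a) (es ! a)
        = (\<Sum>b<length fs. cinner I (es ! a) (fs ! b) * cinner I (fs ! b) (es ! a))"
      by (intro parseval[OF fs] esX) simp
    then show "(\<Sum>b<length fs. of_real (ps ! a * ln (ps ! a))
          * (cinner I (es ! a) (fs ! b) * cinner I (fs ! b) (es ! a)))
        = complex_of_real (ps ! a * ln (ps ! a)) * cinner I (es ! a) (es ! a)"
      by (simp add: sum_distrib_left)
  qed simp
  also have "\<dots> = of_real (\<Sum>a<length es. ps ! a * ln (ps ! a))"
    unfolding of_real_sum by (rule sum.cong) (use es in \<open>auto simp: orthonormal_basis_def\<close>)
  finally have "von_neumann_entropy I X ?T = - (\<Sum>a<length es. ps ! a * ln (ps ! a))"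
    unfolding von_neumann_entropy_def by (simp only: Re_complex_of_real)
  with sp that show ?thesis by blast
qed

subsection \<open>Contractions of intertwiners\<close>

text \<open>Indices are split off at the end of the list because the common edge is the last tensor
  factor; the inductions over spins follow the same splitting.\<close>

lemma spin_basis_snoc: "spin_basis (ns @ [n]) = (\<lambda>(as, k). as @ [k]) ` (spin_basis ns \<times> {..n})"
proof (intro Set.set_eqI iffI)
  fix x assume x: "x \<in> spin_basis (ns @ [n])"
  then have "length x = Suc (length ns)" by (simp add: spin_basis_def)
  then obtain as k where ak: "x = as @ [k]" "length as = length ns"
    by (metis append_butlast_last_id length_butlast diff_Suc_1 list.size(3) nat.distinct(1))
  have "as ! i \<le> ns ! i" if "i < length ns" for i
    using x that ak unfolding spin_basis_def by (auto simp: nth_append dest!: spec[of _ i])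
  moreover have "k \<le> n"
    using x ak unfolding spin_basis_def by (auto simp: nth_append dest!: spec[of _ "length ns"])
  ultimately show "x \<in> (\<lambda>(as, k). as @ [k]) ` (spin_basis ns \<times> {..n})"
    using ak by (auto simp: spin_basis_def)
next
  fix x assume "x \<in> (\<lambda>(as, k). as @ [k]) ` (spin_basis ns \<times> {..n})"
  then show "x \<in> spin_basis (ns @ [n])"
    by (auto simp: spin_basis_def nth_append less_Suc_eq)
qed

lemma append_mem_spin_basis:
  "as @ [k] \<in> spin_basis (ns @ [n]) \<longleftrightarrow> as \<in> spin_basis ns \<and> k \<le> n"
  by (auto simp: spin_basis_snoc)

lemma sum_spin_basis_snoc:
  "(\<Sum>x\<in>spin_basis (ns @ [n]). f x) = (\<Sum>as\<in>spin_basis ns. \<Sum>k\<le>n. f (as @ [k]))"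
proof -
  have "inj_on (\<lambda>(as, k). as @ [k]) (spin_basis ns \<times> {..n})"
    by (auto simp: inj_on_def)
  then show ?thesis
    unfolding spin_basis_snoc by (simp add: sum.reindex sum.cartesian_product split_def)
qed

lemma spin_basis_Nil: "spin_basis [] = {[]}"
  by (auto simp: spin_basis_def)

lemma finite_spin_basis: "finite (spin_basis ns)"
  by (induction ns rule: rev_induct) (simp_all add: spin_basis_Nil spin_basis_snoc)

text \<open>\<open>SU2\<close> is defined by a right inverse. For square matrices it is also a left
  inverse, which turns orthonormality of rows into that of columns.\<close>

lemma wigner_unitary_columns:
  assumes "g \<in> SU2" "k \<le> n" "l \<le> n"
  shows "(\<Sum>p\<le>n. cnj (wigner n g p k) * wigner n g p l) = (if k = l then 1 else 0)"
proof -
  let ?h = "\<chi> i j. cnj (g $ j $ i)"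
  have "?h ** g = Finite_Cartesian_Product.mat 1"
    using assms(1) matrix_left_right_inverse unfolding SU2_def by blast
  moreover have "wigner n (?h ** g) k l = (\<Sum>p\<le>n. cnj (wigner n g p k) * wigner n g p l)"
    using assms by (simp add: wigner_mult wigner_adjoint)
  ultimately show ?thesis using assms by (simp add: wigner_one)
qed

section \<open>The product representation and its invariant vectors\<close>

definition spin_mat :: "nat list \<Rightarrow> complex^2^2 \<Rightarrow> nat list \<Rightarrow> nat list \<Rightarrow> complex" where
  "spin_mat ns g as bs = (\<Prod>i<length ns. wigner (ns ! i) g (as ! i) (bs ! i))"

lemma spin_mat_snoc:
  assumes "as \<in> spin_basis ns" "bs \<in> spin_basis ns"
  shows "spin_mat (ns @ [n]) g (as @ [k]) (bs @ [l]) = spin_mat ns g as bs * wigner n g k l"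
  using assms by (auto simp: spin_mat_def spin_basis_def nth_append lessThan_Suc mult.commute intro!: prod.cong)

lemma spin_mat_unitary:
  assumes g: "g \<in> SU2" and "bs \<in> spin_basis ns" "cs \<in> spin_basis ns"
  shows "(\<Sum>as\<in>spin_basis ns. cnj (spin_mat ns g as bs) * spin_mat ns g as cs) = (if bs = cs then 1 else 0)"
  using assms(2,3)
proof (induction ns arbitrary: bs cs rule: rev_induct)
  case Nil
  then show ?case by (simp add: spin_basis_Nil spin_mat_def)
next
  case (snoc n ns)
  obtain b l c m where bc: "bs = b @ [l]" "b \<in> spin_basis ns" "l \<le> n" "cs = c @ [m]" "c \<in> spin_basis ns" "m \<le> n"
    using snoc.prems unfolding spin_basis_snoc by auto
  have "(\<Sum>as\<in>spin_basis (ns @ [n]). cnj (spin_mat (ns @ [n]) g as bs) * spin_mat (ns @ [n]) g as cs)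
      = (\<Sum>as\<in>spin_basis ns. \<Sum>k\<le>n. (cnj (spin_mat ns g as b) * spin_mat ns g as c)
          * (cnj (wigner n g k l) * wigner n g k m))"
    unfolding sum_spin_basis_snoc bc using bc
    by (intro sum.cong refl) (simp add: spin_mat_snoc)
  also have "\<dots> = (if b = c then 1 else 0) * (if l = m then 1 else 0)"
    unfolding sum_product[symmetric] snoc.IH[OF bc(2,5)] wigner_unitary_columns[OF g bc(3,6)] ..
  finally show ?case by (simp add: bc)
qed

text \<open>The diagonal action is factored into the Wigner matrix of the last factor and the action
  on the others, so that invariance of \<open>v\<close> becomes a transformation law for its
  contractions.\<close>

lemma intertwiner_invariance:
  assumes "v \<in> intertwiners (ns @ [n])" "g \<in> SU2" "as \<in> spin_basis ns" "k \<le> n"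
  shows "v (as @ [k]) = (\<Sum>p\<le>n. wigner n g k p * (\<Sum>bs\<in>spin_basis ns. spin_mat ns g as bs * v (bs @ [p])))"
proof -
  have "v (as @ [k]) = spin_action (ns @ [n]) g v (as @ [k])"
    using assms by (simp add: intertwiners_def)
  also have "\<dots> = (\<Sum>bs\<in>spin_basis ns. \<Sum>p\<le>n. spin_mat (ns @ [n]) g (as @ [k]) (bs @ [p]) * v (bs @ [p]))"
    using assms unfolding spin_action_def spin_mat_def[symmetric]
    by (simp add: append_mem_spin_basis sum_spin_basis_snoc)
  also have "\<dots> = (\<Sum>bs\<in>spin_basis ns. \<Sum>p\<le>n. wigner n g k p * (spin_mat ns g as bs * v (bs @ [p])))"
    using assms by (intro sum.cong refl) (simp add: spin_mat_snoc)
  finally show ?thesis by (subst (asm) sum.swap) (simp add: sum_distrib_left)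
qed

lemma cinner_spin_mat:
  assumes g: "g \<in> SU2"
  shows "cinner (spin_basis ns) (\<lambda>as. \<Sum>bs\<in>spin_basis ns. spin_mat ns g as bs * v bs)
      (\<lambda>as. \<Sum>bs\<in>spin_basis ns. spin_mat ns g as bs * w bs) = cinner (spin_basis ns) v w"
proof -
  let ?S = "spin_basis ns"
  have "cinner ?S (\<lambda>as. \<Sum>bs\<in>?S. v bs * spin_mat ns g as bs) (\<lambda>as. \<Sum>cs\<in>?S. w cs * spin_mat ns g as cs)
      = (\<Sum>bs\<in>?S. cnj (v bs) * (\<Sum>cs\<in>?S. w cs * cinner ?S (\<lambda>as. spin_mat ns g as bs) (\<lambda>as. spin_mat ns g as cs)))"
    unfolding cinner_sum_left cinner_sum_right ..
  also have "\<dots> = (\<Sum>bs\<in>?S. cnj (v bs) * (\<Sum>cs\<in>?S. if cs = bs then w cs else 0))"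
    by (intro sum.cong refl arg_cong2[of _ _ _ _ "(*)"])
      (auto simp: cinner_def spin_mat_unitary[OF g])
  also have "\<dots> = cinner ?S v w"
    by (simp add: cinner_def finite_spin_basis)
  finally show ?thesis by (simp add: mult.commute)
qed

section \<open>Schur's lemma from explicit group elements\<close>

lemma diagonal_in_SU2: "vector [vector [cis (- t), 0], vector [0, cis t]] \<in> SU2"
  by (simp add: SU2_def Finite_Cartesian_Product.vec_eq_iff forall_2 matrix_matrix_mult_def
      sum_2 Finite_Cartesian_Product.mat_def Determinants.det_2 cis_cnj cis_mult)

text \<open>The 3-4-5 triangle keeps the entries rational; what matters later is that both entries
  of the second column are nonzero.\<close>

lemma rotation_in_SU2: "vector [vector [3/5, 4/5], vector [-4/5, 3/5]] \<in> SU2"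
  by (simp add: SU2_def Finite_Cartesian_Product.vec_eq_iff forall_2 matrix_matrix_mult_def
      sum_2 Finite_Cartesian_Product.mat_def Determinants.det_2)

lemma coeff_linear_power: "coeff ([:a, b:] ^ n) k = of_nat (n choose k) * a ^ (n - k) * b ^ k" for a b :: complex
proof (induction n arbitrary: k)
  case (Suc n)
  show ?case
  proof (cases k)
    case 0
    then show ?thesis by (simp add: coeff_linear_mult Suc del: mult_pCons_left)
  next
    case (Suc m)
    show ?thesis
    proof (cases "m < n")
      case True
      then obtain d where d: "n = Suc (m + d)" using less_iff_Suc_add by blast
      show ?thesis
        unfolding power_Suc coeff_linear_mult Suc.IH by (simp add: Suc d algebra_simps)
    next
      case False
      then show ?thesis
        unfolding power_Suc coeff_linear_mult Suc.IH by (simp add: Suc binomial_eq_0 algebra_simps)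
    qed
  qed
qed (cases k; simp)

text \<open>Diagonal elements of SU(2) force \<open>M\<close> to be diagonal; a rotation with no vanishing
  entry in its first Wigner column makes the diagonal constant.\<close>

lemma wigner_schur:
  assumes comm: "\<And>g k r. g \<in> SU2 \<Longrightarrow> k \<le> n \<Longrightarrow> r \<le> n \<Longrightarrow>
      (\<Sum>l\<le>n. M k l * cnj (wigner n g l r)) = (\<Sum>p\<le>n. cnj (wigner n g k p) * M p r)"
    and kr: "k \<le> n" "r \<le> n"
  shows "M k r = (if k = r then M 0 0 else 0)"
proof -
  have off: "M k r = 0" if kr: "k \<le> n" "r \<le> n" "k \<noteq> r" for k r
  proof -
    \<comment> \<open>With this angle the phases at \<open>k\<close> and \<open>r\<close> differ by
      \<open>pi\<close>, so that \<open>d k = - d r\<close>.\<close>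
    define \<theta> where "\<theta> = pi / (real r - real k)"
    define d where "d l = cis (- \<theta> * (real l - real n / 2))" for l
    define g :: "complex^2^2" where "g = vector [vector [cis (-\<theta>/2), 0], vector [0, cis (\<theta>/2)]]"
    have g: "g \<in> SU2" using diagonal_in_SU2[of "\<theta>/2"] by (simp add: g_def)
    have w: "wigner n g l m = (if l = m then d l else 0)" if "l \<le> n" "m \<le> n" for l m
      using wigner_Jz[OF that] unfolding g_def d_def .
    have "(\<Sum>l\<le>n. M k l * cnj (wigner n g l r)) = (\<Sum>l\<le>n. if l = r then M k l * cnj (d r) else 0)"
      using kr by (intro sum.cong) (auto simp: w)
    also have "\<dots> = M k r * cnj (d r)" using kr by simp
    finally have A: "(\<Sum>l\<le>n. M k l * cnj (wigner n g l r)) = M k r * cnj (d r)" .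
    have "(\<Sum>p\<le>n. cnj (wigner n g k p) * M p r) = (\<Sum>p\<le>n. if p = k then cnj (d k) * M p r else 0)"
      using kr by (intro sum.cong) (auto simp: w)
    also have "\<dots> = cnj (d k) * M k r" using kr by simp
    finally have "M k r * cnj (d r) = cnj (d k) * M k r"
      using comm[OF g kr(1,2)] unfolding A by (rule trans[rotated])
    then have "M k r = 0 \<or> cnj (d k) = cnj (d r)" by (auto simp: mult.commute)
    moreover have "d k = - d r"
    proof -
      have "- \<theta> * (real k - real n / 2) = pi + - \<theta> * (real r - real n / 2)"
        using kr(3) by (simp add: \<theta>_def field_simps)
      then have "d k = cis pi * d r" unfolding d_def cis_mult by simp
      then show ?thesis by simp
    qed
    moreover have "d r \<noteq> 0" by (simp add: d_def)
    ultimately show ?thesis by (auto simp: neg_eq_iff_add_eq_0)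
  qed
  \<comment> \<open>As \<open>M\<close> is already diagonal, commutation with the rotation compares
    \<open>M k k\<close> and \<open>M 0 0\<close> through the single entry
    \<open>wigner n ?g k 0\<close>, a nonzero multiple of
    \<open>(4/5) ^ k * (3/5) ^ (n - k)\<close>.\<close>
  have "M k k = M 0 0"
  proof -
    let ?g = "vector [vector [3/5, 4/5], vector [-4/5, 3/5]] :: complex^2^2"
    have "(\<Sum>l\<le>n. M k l * cnj (wigner n ?g l 0)) = (\<Sum>l\<le>n. if l = k then M k k * cnj (wigner n ?g k 0) else 0)"
      using kr off by (intro sum.cong) auto
    also have "\<dots> = M k k * cnj (wigner n ?g k 0)" using kr by simp
    finally have A: "(\<Sum>l\<le>n. M k l * cnj (wigner n ?g l 0)) = M k k * cnj (wigner n ?g k 0)" .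
    have "(\<Sum>p\<le>n. cnj (wigner n ?g k p) * M p 0) = (\<Sum>p\<le>n. if p = 0 then cnj (wigner n ?g k 0) * M 0 0 else 0)"
      using off by (intro sum.cong) auto
    also have "\<dots> = cnj (wigner n ?g k 0) * M 0 0" by simp
    finally have "M k k * cnj (wigner n ?g k 0) = cnj (wigner n ?g k 0) * M 0 0"
      using comm[OF rotation_in_SU2 kr(1), of 0] unfolding A by simp
    moreover have "wigner n ?g k 0 \<noteq> 0"
      using kr(1) by (simp add: wigner_def wigner_poly_def coeff_linear_power)
    ultimately show ?thesis by (simp add: mult.commute)
  qed
  with off[OF kr] show ?thesis by (cases "k = r") auto
qed

lemma cinner_cong:
  "(\<And>i. i \<in> I \<Longrightarrow> u i = u' i) \<Longrightarrow> (\<And>i. i \<in> I \<Longrightarrow> v i = v' i) \<Longrightarrow> cinner I u v = cinner I u' v'"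
  by (simp add: cinner_def)

text \<open>Let W be the Wigner matrix of a group element. Invariance says that the matrix
  \<open>M\<close> of these inner products equals conj(W) M W^T, the conjugate standing on the left
  because \<open>cinner\<close> is antilinear in its first argument. Multiplying by conj(W) on the
  right shows that \<open>M\<close> commutes with every conj(W), hence is scalar. Its trace is the
  inner product of \<open>v\<close> and \<open>w\<close>, which fixes the scalar.\<close>

lemma intertwiner_contraction:
  assumes v: "v \<in> intertwiners (ns @ [n])" and w: "w \<in> intertwiners (ns @ [n])" and kl: "k \<le> n" "l \<le> n"
  shows "cinner (spin_basis ns) (\<lambda>as. v (as @ [k])) (\<lambda>as. w (as @ [l]))
    = (if k = l then cinner (spin_basis (ns @ [n])) v w / of_nat (n + 1) else 0)"
proof -
  let ?S = "spin_basis ns"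
  define M where "M k l = cinner ?S (\<lambda>as. v (as @ [k])) (\<lambda>as. w (as @ [l]))" for k l
  have M: "M k l = (\<Sum>p\<le>n. cnj (wigner n g k p) * (\<Sum>q\<le>n. wigner n g l q * M p q))"
    if g: "g \<in> SU2" and kl: "k \<le> n" "l \<le> n" for g k l
  proof -
    have "M k l = cinner ?S
        (\<lambda>as. \<Sum>p\<le>n. wigner n g k p * (\<Sum>bs\<in>?S. spin_mat ns g as bs * v (bs @ [p])))
        (\<lambda>as. \<Sum>p\<le>n. wigner n g l p * (\<Sum>bs\<in>?S. spin_mat ns g as bs * w (bs @ [p])))"
      unfolding M_def
      by (intro cinner_cong intertwiner_invariance[OF v g _ kl(1)] intertwiner_invariance[OF w g _ kl(2)])
    then show ?thesis
      unfolding cinner_sum_left cinner_sum_right cinner_spin_mat[OF g] M_def[symmetric] .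
  qed
  have "M k l = (if k = l then M 0 0 else 0)" if "k \<le> n" "l \<le> n" for k l
  proof (rule wigner_schur[OF _ that])
    fix g :: "complex^2^2" and k r assume g: "g \<in> SU2" and kr: "k \<le> n" "r \<le> n"
    have "(\<Sum>l\<le>n. M k l * cnj (wigner n g l r))
        = (\<Sum>l\<le>n. \<Sum>p\<le>n. \<Sum>q\<le>n. cnj (wigner n g k p) * M p q * (cnj (wigner n g l r) * wigner n g l q))"
    proof (intro sum.cong refl)
      fix l assume l: "l \<in> {..n}"
      show "M k l * cnj (wigner n g l r)
        = (\<Sum>p\<le>n. \<Sum>q\<le>n. cnj (wigner n g k p) * M p q * (cnj (wigner n g l r) * wigner n g l q))"
        by (subst M[OF g kr(1)]) (use l in \<open>auto simp: sum_distrib_left sum_distrib_right mult_ac\<close>)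
    qed
    also have "\<dots> = (\<Sum>p\<le>n. \<Sum>q\<le>n. cnj (wigner n g k p) * M p q * (\<Sum>l\<le>n. cnj (wigner n g l r) * wigner n g l q))"
      unfolding sum_distrib_left by (subst sum.swap, rule sum.cong[OF refl], rule sum.swap)
    also have "\<dots> = (\<Sum>p\<le>n. \<Sum>q\<le>n. if q = r then cnj (wigner n g k p) * M p q else 0)"
      using kr by (intro sum.cong refl) (auto simp: wigner_unitary_columns[OF g])
    also have "\<dots> = (\<Sum>p\<le>n. cnj (wigner n g k p) * M p r)"
      using kr by simp
    finally show "(\<Sum>l\<le>n. M k l * cnj (wigner n g l r)) = (\<Sum>p\<le>n. cnj (wigner n g k p) * M p r)" .
  qed
  note schur = this
  have "cinner (spin_basis (ns @ [n])) v w = (\<Sum>k\<le>n. M k k)"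
    unfolding cinner_def sum_spin_basis_snoc M_def by (rule sum.swap)
  also have "\<dots> = (\<Sum>k\<le>n. M 0 0)"
  proof (rule sum.cong[OF refl])
    fix k assume "k \<in> {..n}"
    then show "M k k = M 0 0" using schur[of k k] by simp
  qed
  finally have "M 0 0 = cinner (spin_basis (ns @ [n])) v w / of_nat (n + 1)"
    by (simp add: field_simps del: of_nat_Suc)
  with schur[OF kl] show ?thesis unfolding M_def by simp
qed

lemma subspace_on_spin_space: "subspace_on (spin_basis ns) (spin_space ns)"
  by (auto simp: subspace_on_def spin_space_def)

lemma spin_action_linear:
  "spin_action ns g (\<lambda>i. c * x i + d * y i) = (\<lambda>i. c * spin_action ns g x i + d * spin_action ns g y i)"
  by (auto simp: spin_action_def sum_distrib_left sum.distrib algebra_simps)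

lemma subspace_on_intertwiners: "subspace_on (spin_basis ns) (intertwiners ns)"
  using subspace_on_spin_space[of ns]
  by (auto simp: subspace_on_def intertwiners_def spin_action_linear) (auto simp: spin_action_def)

subsection \<open>Entanglement\<close>

text \<open>Parseval in \<open>Y\<close> sums out the basis hidden in
  \<open>reduced_density\<close>, leaving the Gram matrix of slices. The index \<open>k\<close>
  comes first because its slice enters conjugated.\<close>

lemma reduced_density_kernel:
  assumes "finite J" "subspace_on J Y" and Y: "\<And>i. (\<lambda>j. \<phi> (i, j)) \<in> Y"
  shows "reduced_density I J Y \<phi> = kernel_op I (\<lambda>i k. cinner J (\<lambda>j. \<phi> (k, j)) (\<lambda>j. \<phi> (i, j)))"
proof (intro ext)
  fix x i
  define fs where "fs = some_onb J Y"
  have fs: "orthonormal_basis J Y fs"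
    using orthonormal_basis_exists[OF assms(1,2)] someI_ex[of "orthonormal_basis J Y"]
    unfolding fs_def some_onb_def by blast
  let ?c = "\<lambda>b i. cinner J (fs ! b) (\<lambda>j. \<phi> (i, j))"
  have p: "partial_inner J f \<phi> = (\<lambda>i. cinner J f (\<lambda>j. \<phi> (i, j)))" for f
    by (simp add: partial_inner_def cinner_def)
  have "reduced_density I J Y \<phi> x i = (\<Sum>b<length fs. ?c b i * (\<Sum>k\<in>I. cnj (?c b k) * x k))"
    unfolding reduced_density_def fs_def[symmetric] p
    by (simp add: sum_list_sum_nth atLeast0LessThan cinner_def[of I])
  also have "\<dots> = (\<Sum>k\<in>I. (\<Sum>b<length fs. cinner J (\<lambda>j. \<phi> (k, j)) (fs ! b) * ?c b i) * x k)"
    unfolding sum_distrib_left sum_distrib_right cnj_cinner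
    by (subst sum.swap) (simp add: mult_ac)
  also have "\<dots> = kernel_op I (\<lambda>i k. cinner J (\<lambda>j. \<phi> (k, j)) (\<lambda>j. \<phi> (i, j))) x i"
    unfolding kernel_op_def parseval[OF fs Y, symmetric] ..
  finally show "reduced_density I J Y \<phi> x i
      = kernel_op I (\<lambda>i k. cinner J (\<lambda>j. \<phi> (k, j)) (\<lambda>j. \<phi> (i, j))) x i" .
qed

lemma entanglement_spectral:
  assumes I: "finite I" and X: "subspace_on I X" and J: "finite J" and Y: "subspace_on J Y"
    and \<phi>Y: "\<And>i. (\<lambda>j. \<phi> (i, j)) \<in> Y" and \<phi>X: "\<And>j. (\<lambda>i. \<phi> (i, j)) \<in> X"
  obtains es ps where
    "spectral_decomposition I X (kernel_op I (\<lambda>i k. cinner J (\<lambda>j. \<phi> (k, j)) (\<lambda>j. \<phi> (i, j)))) es ps"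
    "entanglement I J X Y \<phi> = - (\<Sum>a<length es. ps ! a * ln (ps ! a))"
proof -
  let ?R = "\<lambda>i k. cinner J (\<lambda>j. \<phi> (k, j)) (\<lambda>j. \<phi> (i, j))"
  have herm: "hermitian_kernel ?R"
    by (simp add: hermitian_kernel_def cnj_cinner)
  \<comment> \<open>All values of the operator are combinations of the slices
    \<open>\<lambda>i. \<phi> (i, j)\<close>, which lie in \<open>X\<close>.\<close>
  have inv: "kernel_op I ?R x \<in> X" for x
  proof -
    have "kernel_op I ?R x = (\<lambda>i. \<Sum>j\<in>J. (\<Sum>k\<in>I. cnj (\<phi> (k, j)) * x k) * \<phi> (i, j))"
      unfolding kernel_op_def cinner_def sum_distrib_right
      by (subst sum.swap) (simp add: mult_ac)
    then show ?thesis by (simp only: subspace_on_sum[OF X \<phi>X])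
  qed
  obtain es0 ps0 where "spectral_decomposition I X (kernel_op I ?R) es0 ps0"
    by (rule spectral_decomposition_exists[OF I X herm inv])
  then obtain es ps where sd: "spectral_decomposition I X (kernel_op I ?R) es ps"
    and vn: "von_neumann_entropy I X (kernel_op I ?R) = - (\<Sum>a<length es. ps ! a * ln (ps ! a))"
    by (rule von_neumann_entropy_spectral)
  have "entanglement I J X Y \<phi> = - (\<Sum>a<length es. ps ! a * ln (ps ! a))"
    unfolding entanglement_def reduced_density_kernel[OF J Y \<phi>Y] by (rule vn)
  with sd show ?thesis by (rule that)
qed

text \<open>The column at \<open>k\<close> lies in \<open>X\<close>, so it expands in the
  eigenbasis. Hermiticity turns its coefficients into conjugated values at \<open>k\<close> of the
  operator applied to the eigenvectors.\<close>

lemma spectral_decomposition_kernel: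
  assumes sd: "spectral_decomposition I X (kernel_op I R) es ps"
    and herm: "hermitian_kernel R" and "(\<lambda>i. R i k) \<in> X" "k \<in> I"
  shows "R i k = (\<Sum>a<length es. of_real (ps ! a) * (es ! a) i * cnj ((es ! a) k))"
proof -
  have es: "orthonormal_basis I X es" using sd by (simp add: spectral_decomposition_def)
  have c: "cinner I (es ! a) (\<lambda>i. R i k) = of_real (ps ! a) * cnj ((es ! a) k)" if "a < length es" for a
  proof -
    have "cnj (R i k) = R k i" for i
      using herm unfolding hermitian_kernel_def by metis
    then have "cinner I (es ! a) (\<lambda>i. R i k) = cnj (kernel_op I R (es ! a) k)"
      unfolding cnj_cinner[of I "\<lambda>i. R i k" "es ! a", symmetric]
      by (simp add: cinner_def kernel_op_def)
    also have "kernel_op I R (es ! a) k = of_real (ps ! a) * (es ! a) k"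
      using sd that by (simp add: spectral_decomposition_def)
    finally show ?thesis by simp
  qed
  have "R i k = (\<Sum>a<length es. cinner I (es ! a) (\<lambda>i. R i k) * (es ! a) i)"
    using fun_cong[OF orthonormal_basis_expansion[OF es assms(3)], of i] .
  also have "\<dots> = (\<Sum>a<length es. of_real (ps ! a) * (es ! a) i * cnj ((es ! a) k))"
    by (rule sum.cong) (auto simp: c)
  finally show ?thesis .
qed

text \<open>Freezing one index leaves a combination of the factors for the free index. This is how
  superpositions are handled: every slice of the state is again an intertwiner.\<close>

lemma tensor_space_slices:
  assumes "\<phi> \<in> tensor_space X Y" "subspace_on I X" "subspace_on J Y"
  shows "(\<lambda>j. \<phi> (i, j)) \<in> Y" "(\<lambda>i. \<phi> (i, j)) \<in> X"
proof -
  obtain m :: nat and x y where xy: "\<forall>r<m. x r \<in> X \<and> y r \<in> Y" "\<phi> = (\<lambda>(a, b). \<Sum>r<m. x r a * y r b)"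
    using assms(1) unfolding tensor_space_def by blast
  have "(\<lambda>j. \<Sum>r<m. x r i * y r j) \<in> Y"
    by (rule subspace_on_sum[OF assms(3)]) (use xy in auto)
  then show "(\<lambda>j. \<phi> (i, j)) \<in> Y" by (simp add: xy)
  have "(\<lambda>i. \<Sum>r<m. y r j * x r i) \<in> X"
    by (rule subspace_on_sum[OF assms(2)]) (use xy in auto)
  then show "(\<lambda>i. \<phi> (i, j)) \<in> X" by (simp add: xy mult.commute)
qed

text \<open>Schur's lemma on the B side removes the terms that mix different \<open>k\<close>, so
  each sign of the gluing map meets only itself and cancels. One denominator \<open>n + 1\<close> is
  the squared gluing prefactor, the other the contraction factor.\<close>

lemma gluing_gram:
  assumes Y: "\<And>i. (\<lambda>j. \<psi> (i, j)) \<in> intertwiners (ks @ [n])"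
  shows "cinner (spin_basis ks) (\<lambda>bs. gluing n \<psi> (as', bs)) (\<lambda>bs. gluing n \<psi> (as, bs))
    = (\<Sum>k\<le>n. cinner (spin_basis (ks @ [n])) (\<lambda>j. \<psi> (as' @ [k], j)) (\<lambda>j. \<psi> (as @ [k], j))) / (of_nat (n + 1))\<^sup>2"
proof -
  let ?J = "spin_basis ks"
  let ?N = "of_nat (n + 1) :: complex"
  define c :: "nat \<Rightarrow> complex" where "c k = (-1) ^ (n - k) / of_real (sqrt (real (n + 1)))" for k
  define G where "G k = cinner (spin_basis (ks @ [n])) (\<lambda>j. \<psi> (as' @ [k], j)) (\<lambda>j. \<psi> (as @ [k], j))" for k
  have g: "(\<lambda>bs. gluing n \<psi> (as, bs)) = (\<lambda>bs. \<Sum>k\<le>n. c k * \<psi> (as @ [k], bs @ [n - k]))" for as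
    by (simp add: gluing_def c_def sum_distrib_left)
  have cc: "cnj (c k) * c k = 1 / ?N" for k
  proof -
    have "complex_of_real (sqrt (real (n + 1))) * of_real (sqrt (real (n + 1))) = ?N"
      by (simp flip: of_real_mult)
    then show ?thesis by (simp add: c_def flip: power_mult_distrib)
  qed
  have "cinner ?J (\<lambda>bs. gluing n \<psi> (as', bs)) (\<lambda>bs. gluing n \<psi> (as, bs))
      = (\<Sum>k\<le>n. cnj (c k) * (\<Sum>l\<le>n. c l *
          cinner ?J (\<lambda>bs. \<psi> (as' @ [k], bs @ [n - k])) (\<lambda>bs. \<psi> (as @ [l], bs @ [n - l]))))"
    unfolding g cinner_sum_left cinner_sum_right ..
  also have "\<dots> = (\<Sum>k\<le>n. cnj (c k) * (\<Sum>l\<le>n. if l = k then c k * (G k / ?N) else 0))"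
  proof (intro sum.cong refl arg_cong2[of _ _ _ _ "(*)"])
    \<comment> \<open>On \<open>{..n}\<close> the map sending \<open>k\<close> to
      \<open>n - k\<close> is injective, so the case split on \<open>n - k = n - l\<close> is one on
      \<open>k = l\<close>.\<close>
    fix k l assume "k \<in> {..n}" "l \<in> {..n}"
    then show "c l * cinner ?J (\<lambda>bs. \<psi> (as' @ [k], bs @ [n - k])) (\<lambda>bs. \<psi> (as @ [l], bs @ [n - l]))
        = (if l = k then c k * (G k / ?N) else 0)"
      using intertwiner_contraction[OF Y[of "as' @ [k]"] Y[of "as @ [l]"], of "n - k" "n - l"]
      by (auto simp: G_def)
  qed
  also have "\<dots> = (\<Sum>k\<le>n. (cnj (c k) * c k) * (G k / ?N))"
    by (intro sum.cong refl) (simp add: mult.assoc)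
  also have "\<dots> = (\<Sum>k\<le>n. G k) / ?N\<^sup>2"
    by (simp only: cc) (simp add: sum_divide_distrib power2_eq_square)
  finally show ?thesis unfolding G_def .
qed

lemma cinner_Times:
  "cinner (I \<times> J) \<phi> \<phi> = (\<Sum>i\<in>I. cinner J (\<lambda>j. \<phi> (i, j)) (\<lambda>j. \<phi> (i, j)))"
  by (simp add: cinner_def sum.cartesian_product split_def)

lemma cnorm_eq_iff: "0 \<le> c \<Longrightarrow> cnorm I v = c \<longleftrightarrow> cinner I v v = of_real (c\<^sup>2)"
proof -
  assume "0 \<le> c"
  have "(\<Sum>i\<in>I. (cmod (v i))\<^sup>2) \<ge> 0" by (simp add: sum_nonneg)
  then show ?thesis
    using \<open>0 \<le> c\<close> unfolding cnorm_def cinner_self Re_complex_of_real of_real_eq_iff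
    by (metis real_sqrt_pow2 real_sqrt_abs abs_of_nonneg)
qed

section \<open>Comparison of the spectra before and after gluing\<close>

theorem propositionI1:
  fixes js ks :: "nat list" and n :: nat
    and \<psi> :: "nat list \<times> nat list \<Rightarrow> complex"
  assumes "length js \<ge> 1" and "length ks \<ge> 1"
    and "\<psi> \<in> tensor_space (intertwiners (js @ [n])) (intertwiners (ks @ [n]))"
    and "cnorm (spin_basis (js @ [n]) \<times> spin_basis (ks @ [n])) \<psi> = 1"
  shows "boundary_entanglement js ks n \<psi> =
     intertwiner_entanglement js ks n \<psi> + ln (real n + 1)"
proof -
  let ?I = "spin_basis (js @ [n])" and ?J = "spin_basis (ks @ [n])"
  let ?A = "spin_basis js" and ?B = "spin_basis ks"
  let ?X = "intertwiners (js @ [n])" and ?Y = "intertwiners (ks @ [n])"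
  let ?N = "real (n + 1)"
  note slices = tensor_space_slices[OF assms(3) subspace_on_intertwiners subspace_on_intertwiners]
  define R where "R i k = cinner ?J (\<lambda>j. \<psi> (k, j)) (\<lambda>j. \<psi> (i, j))" for i k
  obtain es ps where sd: "spectral_decomposition ?I ?X (kernel_op ?I R) es ps"
    and E: "intertwiner_entanglement js ks n \<psi> = - (\<Sum>a<length es. ps ! a * ln (ps ! a))"
    unfolding intertwiner_entanglement_def R_def
    by (rule entanglement_spectral[OF finite_spin_basis subspace_on_intertwiners
        finite_spin_basis subspace_on_intertwiners slices])
  have es: "orthonormal_basis ?I ?X es"
    using sd by (simp add: spectral_decomposition_def)
  have esX: "es ! a \<in> ?X" if "a < length es" for a
    using es that unfolding orthonormal_basis_def by auto
  have ees: "cinner ?I (es ! a) (es ! b) = (if a = b then 1 else 0)" if "a < length es" "b < length es" for a b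
    using es that unfolding orthonormal_basis_def by auto
  have herm: "hermitian_kernel R"
    by (simp add: hermitian_kernel_def R_def cnj_cinner)
  have RX: "(\<lambda>i. R i k) \<in> ?X" for k
    unfolding R_def cinner_def by (rule subspace_on_sum[OF subspace_on_intertwiners slices(2)])
  note R = spectral_decomposition_kernel[OF sd herm RX]

  \<comment> \<open>The trace serves twice: for the total weight of the eigenvalues and for the norm
    of the glued vector.\<close>
  have trR: "(\<Sum>i\<in>?I. R i i) = 1"
    using assms(4) by (simp add: cnorm_eq_iff cinner_Times R_def)
  have "(\<Sum>i\<in>?I. R i i) = (\<Sum>a<length es. of_real (ps ! a) * cinner ?I (es ! a) (es ! a))"
    unfolding cinner_def sum_distrib_left
    by (subst sum.swap) (auto simp: R mult_ac intro!: sum.cong)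
  also have "\<dots> = of_real (\<Sum>a<length es. ps ! a)"
    by (simp add: ees)
  finally have trp: "(\<Sum>a<length es. ps ! a) = 1"
    using trR by (metis of_real_eq_1_iff)

  have "cinner (?A \<times> ?B) (gluing n \<psi>) (gluing n \<psi>) = (\<Sum>i\<in>?I. R i i) / (of_nat (n + 1))\<^sup>2"
    unfolding cinner_Times gluing_gram[OF slices(1)] sum_spin_basis_snoc[of _ js]
    by (simp add: R_def sum_divide_distrib)
  also have "\<dots> = of_real ((1 / ?N)\<^sup>2)"
    unfolding trR by (simp add: power_divide)
  finally have norm: "cnorm (?A \<times> ?B) (gluing n \<psi>) = 1 / ?N"
    by (subst cnorm_eq_iff) simp_all
  define \<phi> where "\<phi> = normalized (?A \<times> ?B) (gluing n \<psi>)"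
  have \<phi>: "\<phi> p = of_nat (n + 1) * gluing n \<psi> p" for p
    unfolding \<phi>_def normalized_def norm by simp

  have \<psi>0: "\<psi> (i, j) = 0" if "i \<notin> ?I \<or> j \<notin> ?J" for i j
    using that subspace_on_support[OF subspace_on_intertwiners slices(1), of j i]
      subspace_on_support[OF subspace_on_intertwiners slices(2), of i j] by blast
  have glue0: "gluing n \<psi> (as, bs) = 0" if "as \<notin> ?A \<or> bs \<notin> ?B" for as bs
    using that by (auto simp: gluing_def \<psi>0 append_mem_spin_basis)
  \<comment> \<open>Normalizing multiplies by \<open>n + 1\<close>; its square cancels the
    denominator in \<open>gluing_gram\<close>, and the partial trace of \<open>R\<close> over the
    last factor remains.\<close>
  have R\<phi>: "cinner ?B (\<lambda>j. \<phi> (k, j)) (\<lambda>j. \<phi> (i, j)) = (\<Sum>l\<le>n. R (i @ [l]) (k @ [l]))" for i k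
    unfolding \<phi> cinner_scale_left cinner_scale_right gluing_gram[OF slices(1)] R_def
    by (simp add: power2_eq_square del: of_nat_Suc of_nat_add)
  have \<phi>_slices: "(\<lambda>j. \<phi> (i, j)) \<in> spin_space ks" "(\<lambda>i. \<phi> (i, j)) \<in> spin_space js" for i j
    by (auto simp: spin_space_def \<phi> glue0)
  obtain fs qs where
    sd': "spectral_decomposition ?A (spin_space js) (kernel_op ?A (\<lambda>i k. \<Sum>l\<le>n. R (i @ [l]) (k @ [l]))) fs qs"
    and E': "boundary_entanglement js ks n \<psi> = - (\<Sum>a<length fs. qs ! a * ln (qs ! a))"
    unfolding boundary_entanglement_def R\<phi>[symmetric] \<phi>_def[symmetric]
    by (rule entanglement_spectral[OF finite_spin_basis subspace_on_spin_space
        finite_spin_basis subspace_on_spin_space \<phi>_slices])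

  \<comment> \<open>A contracted unit intertwiner has squared norm \<open>1 / ?N\<close>, hence the
    factor \<open>sqrt ?N\<close>.\<close>
  define u :: "nat \<times> nat \<Rightarrow> nat list \<Rightarrow> complex"
    where "u = (\<lambda>(a, l) as. of_real (sqrt ?N) * (es ! a) (as @ [l]))"
  have sq: "complex_of_real (sqrt ?N) * of_real (sqrt ?N) = of_nat (n + 1)"
    by (simp flip: of_real_mult)
  have "(\<Sum>a<length fs. qs ! a * ln (qs ! a))
      = (\<Sum>c\<in>{..<length es} \<times> {..n}. ps ! fst c / ?N * ln (ps ! fst c / ?N))"
  proof (rule spectral_sum_unique[OF sd', where u = u])
    fix c assume "c \<in> {..<length es} \<times> {..n}"
    then obtain a l where c: "c = (a, l)" "a < length es" "l \<le> n" by auto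
    have "(es ! a) (as @ [l]) = 0" if "as \<notin> ?A" for as
      using subspace_on_support[OF subspace_on_intertwiners esX[OF c(2)]] that
      by (simp add: append_mem_spin_basis)
    then show "u c \<in> spin_space js" by (simp add: u_def c spin_space_def)
  next
    fix c d assume "c \<in> {..<length es} \<times> {..n}" "d \<in> {..<length es} \<times> {..n}"
    then obtain a l b m where c: "c = (a, l)" "a < length es" "l \<le> n"
      and d: "d = (b, m)" "b < length es" "m \<le> n" by auto
    have "cinner ?A (u c) (u d) = of_nat (n + 1) *
        cinner ?A (\<lambda>as. (es ! a) (as @ [l])) (\<lambda>as. (es ! b) (as @ [m]))"
      unfolding u_def c d prod.case cinner_scale_left cinner_scale_right mult.assoc[symmetric]
      by (simp only: complex_cnj_complex_of_real sq)
    also have "\<dots> = (if c = d then 1 else 0)"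
      unfolding intertwiner_contraction[OF esX[OF c(2)] esX[OF d(2)] c(3) d(3)] ees[OF c(2) d(2)]
      by (simp add: c d del: of_nat_Suc of_nat_add)
    finally show "cinner ?A (u c) (u d) = (if c = d then 1 else 0)" .
  next
    fix x
    \<comment> \<open>Inserting the eigenexpansion of \<open>R\<close> writes the partial trace as a
      sum over pairs of an eigenvector and a magnetic index. The weight \<open>ps ! a / ?N\<close>
      compensates the two factors \<open>sqrt ?N\<close> contributed by \<open>u\<close>.\<close>
    have "kernel_op ?A (\<lambda>i k. \<Sum>l\<le>n. R (i @ [l]) (k @ [l])) x i
      = (\<Sum>c\<in>{..<length es} \<times> {..n}. of_real (ps ! fst c / ?N) * cinner ?A (u c) x * u c i)" for i
    proof -
      have "kernel_op ?A (\<lambda>i k. \<Sum>l\<le>n. R (i @ [l]) (k @ [l])) x i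
        = (\<Sum>k\<in>?A. \<Sum>l\<le>n. \<Sum>a<length es.
            of_real (ps ! a) * (es ! a) (i @ [l]) * (cnj ((es ! a) (k @ [l])) * x k))"
        unfolding kernel_op_def
        by (intro sum.cong refl) (simp add: R append_mem_spin_basis sum_distrib_right mult.assoc)
      also have "\<dots> = (\<Sum>l\<le>n. \<Sum>a<length es. \<Sum>k\<in>?A.
            of_real (ps ! a) * (es ! a) (i @ [l]) * (cnj ((es ! a) (k @ [l])) * x k))"
        by (subst sum.swap, rule sum.cong[OF refl], rule sum.swap)
      also have "\<dots> = (\<Sum>l\<le>n. \<Sum>a<length es.
            of_real (ps ! a) * (es ! a) (i @ [l]) * cinner ?A (\<lambda>k. (es ! a) (k @ [l])) x)"
        by (simp only: cinner_def sum_distrib_left)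
      also have "\<dots> = (\<Sum>l\<le>n. \<Sum>a<length es. of_real (ps ! a / ?N) * cinner ?A (u (a, l)) x * u (a, l) i)"
      proof (intro sum.cong refl)
        fix l a
        have "of_real (ps ! a / ?N) * cinner ?A (u (a, l)) x * u (a, l) i
          = of_real (ps ! a / ?N) * (of_real (sqrt ?N) * of_real (sqrt ?N))
             * (es ! a) (i @ [l]) * cinner ?A (\<lambda>k. (es ! a) (k @ [l])) x"
          unfolding u_def prod.case cinner_scale_left complex_cnj_complex_of_real by (simp only: mult_ac)
        also have "of_real (ps ! a / ?N) * (complex_of_real (sqrt ?N) * of_real (sqrt ?N)) = of_real (ps ! a)"
          unfolding sq by (simp del: of_nat_Suc of_nat_add)
        finally show "of_real (ps ! a) * (es ! a) (i @ [l]) * cinner ?A (\<lambda>k. (es ! a) (k @ [l])) x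
          = of_real (ps ! a / ?N) * cinner ?A (u (a, l)) x * u (a, l) i" by (rule sym)
      qed
      also have "\<dots> = (\<Sum>c\<in>{..<length es} \<times> {..n}. of_real (ps ! fst c / ?N) * cinner ?A (u c) x * u c i)"
        by (subst sum.swap) (simp add: sum.cartesian_product split_def)
      finally show ?thesis .
    qed
    then show "kernel_op ?A (\<lambda>i k. \<Sum>l\<le>n. R (i @ [l]) (k @ [l])) x
      = (\<lambda>i. \<Sum>c\<in>{..<length es} \<times> {..n}. of_real (ps ! fst c / ?N) * cinner ?A (u c) x * u c i)"
      by (rule ext)
  qed simp_all
  also have "\<dots> = (\<Sum>a<length es. \<Sum>l\<le>n. ps ! a / ?N * ln (ps ! a / ?N))"
    by (simp only: sum.cartesian_product split_def fst_conv)
  \<comment> \<open>The \<open>n + 1\<close> equal terms cancel the denominator in front of the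
    logarithm, but not the one inside it.\<close>
  also have "\<dots> = (\<Sum>a<length es. ps ! a * ln (ps ! a / ?N))"
    by (simp del: of_nat_Suc add: field_simps)
  \<comment> \<open>For \<open>ps ! a = 0\<close> both sides vanish, in accordance with 0 ln 0 =
    0.\<close>
  also have "\<dots> = (\<Sum>a<length es. ps ! a * ln (ps ! a) - ps ! a * ln ?N)"
    by (intro sum.cong refl) (auto simp: ln_div right_diff_distrib)
  also have "\<dots> = (\<Sum>a<length es. ps ! a * ln (ps ! a)) - ln ?N"
    by (simp only: sum_subtractf flip: sum_distrib_right) (simp add: trp)
  finally show ?thesis
    unfolding E E' by (simp add: add.commute)
qed

end
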